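(* Let $\Pi$ be a probability measure on a product $\mathcal X\times\mathcal Y$ of Polish spaces, with marginals $\Pi_X,\Pi_Y$ and conditionals $\Pi(\cdot|x)=\Pi_{Y|X}(\cdot|x)$, $\Pi(\cdot|y)=\Pi_{X|Y}(\cdot|y)$. Assume: (1) for each $x\in\mathcal X$ the kernel $H_{1|x}$ on $\mathcal Y$ is $\Pi(\cdot|x)$-reversible and positive, and there is $\beta_1:(0,\infty)\times\mathcal X\to[0,\infty)$ with $\beta_1(\cdot,x)$ admissible for each $x$ and $\mathrm{Var}_{\Pi(\cdot|x)}(h)\le s\,\mathcal E_{\Pi(\cdot|x)}(H_{1|x},h)+\beta_1(s,x)\|h\|_{\mathrm{osc}}^2$ for all $s>0$, $h\in L^2(\Pi(\cdot|x))$; (2) for each $y\in\mathcal Y$ the kernel $H_{2|y}$ on $\mathcal X$ is $\Pi(\cdot|y)$-reversible and positive, and there is $\beta_2:(0,\infty)\times\mathcal Y\to[0,\infty)$ with $\beta_2(\cdot,y)$ admissible for each $y$ and $\mathrm{Var}_{\Pi(\cdot|y)}(g)\le s\,\mathcal E_{\Pi(\cdot|y)}(H_{2|y},g)+\beta_2(s,y)\|g\|_{\mathrm{osc}}^2$ for all $s>0$, $g\in L^2(\Pi(\cdot|y))$; (3) there is an admissible $\beta_0$ such that the exact Gibbs kernel $P=G_1G_2$ satisfies $\|f\|_\Pi^2\le s\,\mathcal E_\Pi(P^*P,f)+\beta_0(s)\|f\|_{\mathrm{osc}}^2$ for all $s>0$, $f\in L^2_0(\Pi)$. Let $K_0^*,K_1^*,K_2^*$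 be the functions associated with $\beta_0(s)$, $\beta_1(s):=\int_{\mathcal X}\beta_1(s,x)\,\Pi_X(dx)$ and $\beta_2(s):=\int_{\mathcal Y}\beta_2(s,y)\,\Pi_Y(dy)$ respectively. Then the Metropolis-within-Gibbs kernel $P_{1,2}=H_1H_2$ satisfies, for all $f\in L^2_0(\Pi)$ with $0<\|f\|_{\mathrm{osc}}<\infty$, $$\frac{\mathcal E_\Pi(P_{1,2}^*P_{1,2},f)}{\|f\|_{\mathrm{osc}}^2}\ \ge\ K^*\!\left(\frac{\|f\|_\Pi^2}{\|f\|_{\mathrm{osc}}^2}\right),\qquad K^*(v)=2K_1^*\!\left(K_2^*\!\left(\tfrac12K_0^*(v/4)\right)\right).$$
   Context: For a probability measure $\mu$: $L^2_0(\mu)$ is the space of mean-zero functions in $L^2(\mu)$, $\|f\|_\mu^2=\int f^2d\mu$, $\|f\|_{\mathrm{osc}}=\operatorname{ess\,sup}_\mu f-\operatorname{ess\,inf}_\mu f$. A $\mu$-invariant Markov kernel $T$ acts by $(Tf)(x)=\int f(x')T(x,dx')$, $T^*$ is its $L^2(\mu)$-adjoint, and $\mathcal E_\mu(T,f)=\langle (I-T)f,f\rangle_\mu$. A $\mu$-reversible $T$ is positive if $\langle Tf,f\rangle_\mu\ge0$ for all $f\in L^2(\mu)$. Admissible functions: $\beta:(0,\infty)\to[0,\infty)$ decreasing with $\lim_{s\to\infty}\beta(s)=0$ (without loss of generality $\beta\le 1/4$). Functions $\beta_1(s,x),\beta_2(s,y)$ are assumed measurable in the second argument. The function $K^*$ associated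 with $\beta$ is $K^*(v)=\sup_{u\ge0}\{uv-K(u)\}$, $v\ge 0$, where $K(u)=u\,\beta(1/u)$ for $u>0$ and $K(0)=0$. Standing convention: $\beta$'s are normalised so that the associated functions satisfy $K^*(v)\le v$ for $v\in[0,1/4]$. Operators on $L^2(\Pi)$: $G_1f(x,y)=\int f(x,y')\Pi_{Y|X}(dy'|x)$, $G_2f(x,y)=\int f(x',y)\Pi_{X|Y}(dx'|y)$, $H_1f(x,y)=\int f(x,y')H_{1|x}(dy'|y)$, $H_2f(x,y)=\int f(x',y)H_{2|y}(dx'|x)$, where $(x,y)\mapsto H_{1|x}(\cdot|y)$ and $(x,y)\mapsto H_{2|y}(\cdot|x)$ are Markov kernels from $\mathcal X\times\mathcal Y$ to $\mathcal Y$, respectively $\mathcal X$. *)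

theory Defs
  imports "HOL-Probability.Probability"
begin

section \<open>Square-integrable functions and operators\<close>

text \<open>
  Elements of \<open>L\<^sup>2(\<mu>)\<close> are represented by functions, not by equivalence classes. Operators act
  on functions pointwise; where a kernel integral diverges (which, for an operator acting on
  \<open>L\<^sup>2(\<mu>)\<close>, happens on a \<open>\<mu>\<close>-null set only) its value is 0.
\<close>

definition L2 :: "'a measure \<Rightarrow> ('a \<Rightarrow> real) set" where
  "L2 \<mu> = {f \<in> borel_measurable \<mu>. integrable \<mu> (\<lambda>x. (f x)\<^sup>2)}"

definition L2_mean_zero :: "'a measure \<Rightarrow> ('a \<Rightarrow> real) set" where
  "L2_mean_zero \<mu> = {f \<in> L2 \<mu>. (\<integral>x. f x \<partial>\<mu>) = 0}"

definition L2_inner :: "'a measure \<Rightarrow> ('a \<Rightarrow> real) \<Rightarrow> ('a \<Rightarrow> real) \<Rightarrow> real" where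
  "L2_inner \<mu> f g = (\<integral>x. f x * g x \<partial>\<mu>)"

definition L2_norm_sq :: "'a measure \<Rightarrow> ('a \<Rightarrow> real) \<Rightarrow> real" where
  "L2_norm_sq \<mu> f = (\<integral>x. (f x)\<^sup>2 \<partial>\<mu>)"

text \<open>The adjoint is determined only up to \<open>\<mu>\<close>-null sets, hence the choice operator.\<close>

definition L2_adjoint ::
    "'a measure \<Rightarrow> (('a \<Rightarrow> real) \<Rightarrow> ('a \<Rightarrow> real)) \<Rightarrow> (('a \<Rightarrow> real) \<Rightarrow> ('a \<Rightarrow> real))" where
  "L2_adjoint \<mu> T = (SOME S. (\<forall>g \<in> L2 \<mu>. S g \<in> L2 \<mu>) \<and>
     (\<forall>f \<in> L2 \<mu>. \<forall>g \<in> L2 \<mu>. L2_inner \<mu> (T f) g = L2_inner \<mu> f (S g)))"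

definition dirichlet_form ::
    "'a measure \<Rightarrow> (('a \<Rightarrow> real) \<Rightarrow> ('a \<Rightarrow> real)) \<Rightarrow> ('a \<Rightarrow> real) \<Rightarrow> real" where
  "dirichlet_form \<mu> T f = L2_inner \<mu> (\<lambda>x. f x - T f x) f"

text \<open>The essential infimum of \<open>f\<close> is minus the essential supremum of \<open>-f\<close>;
  the oscillation is \<open>\<infinity>\<close> for essentially unbounded \<open>f\<close>.\<close>

definition osc_norm :: "'a measure \<Rightarrow> ('a \<Rightarrow> real) \<Rightarrow> ereal" where
  "osc_norm \<mu> f = esssup \<mu> (\<lambda>x. ereal (f x)) - (- esssup \<mu> (\<lambda>x. - ereal (f x)))"

section \<open>Kernels\<close>

definition kernel_op :: "('a \<Rightarrow> 'b measure) \<Rightarrow> ('b \<Rightarrow> real) \<Rightarrow> 'a \<Rightarrow> real" where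
  "kernel_op T f = (\<lambda>x. \<integral>x'. f x' \<partial>T x)"

text \<open>Detailed balance: \<open>\<mu>(dx) T(x,dx')\<close> is a symmetric measure.\<close>

definition reversible :: "'a measure \<Rightarrow> ('a \<Rightarrow> 'a measure) \<Rightarrow> bool" where
  "reversible \<mu> T \<longleftrightarrow> (\<forall>A \<in> sets \<mu>. \<forall>B \<in> sets \<mu>.
     (\<integral>\<^sup>+x\<in>A. emeasure (T x) B \<partial>\<mu>) = (\<integral>\<^sup>+x\<in>B. emeasure (T x) A \<partial>\<mu>))"

definition positive_kernel :: "'a measure \<Rightarrow> ('a \<Rightarrow> 'a measure) \<Rightarrow> bool" where
  "positive_kernel \<mu> T \<longleftrightarrow> (\<forall>f \<in> L2 \<mu>. 0 \<le> L2_inner \<mu> (kernel_op T f) f)"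

abbreviation marginal_X ::
    "('a::topological_space \<times> 'b::topological_space) measure \<Rightarrow> 'a measure" where
  "marginal_X \<pi> \<equiv> distr \<pi> borel fst"

abbreviation marginal_Y ::
    "('a::topological_space \<times> 'b::topological_space) measure \<Rightarrow> 'b measure" where
  "marginal_Y \<pi> \<equiv> distr \<pi> borel snd"

text \<open>Versions of the regular conditional distributions of \<open>Y\<close> given \<open>X\<close> and of \<open>X\<close> given \<open>Y\<close>.\<close>

definition conditional_Y_given_X ::
    "('a::topological_space \<times> 'b::topological_space) measure \<Rightarrow> ('a \<Rightarrow> 'b measure) \<Rightarrow> bool" where
  "conditional_Y_given_X \<pi> \<kappa> \<longleftrightarrow> \<kappa> \<in> borel \<rightarrow>\<^sub>M prob_algebra borel \<and>
     (\<forall>A \<in> sets borel. \<forall>B \<in> sets borel.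
        emeasure \<pi> (A \<times> B) = (\<integral>\<^sup>+x\<in>A. emeasure (\<kappa> x) B \<partial>marginal_X \<pi>))"

definition conditional_X_given_Y ::
    "('a::topological_space \<times> 'b::topological_space) measure \<Rightarrow> ('b \<Rightarrow> 'a measure) \<Rightarrow> bool" where
  "conditional_X_given_Y \<pi> \<kappa> \<longleftrightarrow> \<kappa> \<in> borel \<rightarrow>\<^sub>M prob_algebra borel \<and>
     (\<forall>A \<in> sets borel. \<forall>B \<in> sets borel.
        emeasure \<pi> (A \<times> B) = (\<integral>\<^sup>+y\<in>B. emeasure (\<kappa> y) A \<partial>marginal_Y \<pi>))"

definition G1_op :: "('a \<Rightarrow> 'b measure) \<Rightarrow> ('a \<times> 'b \<Rightarrow> real) \<Rightarrow> 'a \<times> 'b \<Rightarrow> real" where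
  "G1_op \<kappa>\<^sub>Y f = (\<lambda>(x, y). \<integral>y'. f (x, y') \<partial>\<kappa>\<^sub>Y x)"

definition G2_op :: "('b \<Rightarrow> 'a measure) \<Rightarrow> ('a \<times> 'b \<Rightarrow> real) \<Rightarrow> 'a \<times> 'b \<Rightarrow> real" where
  "G2_op \<kappa>\<^sub>X f = (\<lambda>(x, y). \<integral>x'. f (x', y) \<partial>\<kappa>\<^sub>X y)"

text \<open>\<open>H\<^sub>1 x y\<close> is \<open>H\<^bsub>1|x\<^esub>(\<cdot>|y)\<close>, whereas \<open>H\<^sub>2 y x\<close> is \<open>H\<^bsub>2|y\<^esub>(\<cdot>|x)\<close>: the
  conditioning variable always comes first.\<close>

definition H1_op :: "('a \<Rightarrow> 'b \<Rightarrow> 'b measure) \<Rightarrow> ('a \<times> 'b \<Rightarrow> real) \<Rightarrow> 'a \<times> 'b \<Rightarrow> real" where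
  "H1_op H\<^sub>1 f = (\<lambda>(x, y). \<integral>y'. f (x, y') \<partial>H\<^sub>1 x y)"

definition H2_op :: "('b \<Rightarrow> 'a \<Rightarrow> 'a measure) \<Rightarrow> ('a \<times> 'b \<Rightarrow> real) \<Rightarrow> 'a \<times> 'b \<Rightarrow> real" where
  "H2_op H\<^sub>2 f = (\<lambda>(x, y). \<integral>x'. f (x', y) \<partial>H\<^sub>2 y x)"

section \<open>Rate functions of weak Poincare inequalities\<close>

text \<open>Only the values on \<open>(0,\<infinity>)\<close> matter.\<close>

definition admissible :: "(real \<Rightarrow> real) \<Rightarrow> bool" where
  "admissible \<beta> \<longleftrightarrow> (\<forall>s>0. 0 \<le> \<beta> s) \<and> antimono_on {0<..} \<beta> \<and> (\<beta> \<longlongrightarrow> 0) at_top"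

text \<open>No upper bound such as \<open>\<beta> \<le> 1/4\<close> is imposed on admissible functions, so an average of them
  over \<open>x\<close> may be infinite; this is why \<open>\<beta>\<close> and \<open>K\<close> are extended-valued here. The supremum
  defining \<open>K\<^sup>*\<close> is likewise taken in the extended reals.\<close>

definition averaged_rate :: "'a measure \<Rightarrow> (real \<Rightarrow> 'a \<Rightarrow> real) \<Rightarrow> real \<Rightarrow> ennreal" where
  "averaged_rate \<mu> \<beta> s = (\<integral>\<^sup>+x. ennreal (\<beta> s x) \<partial>\<mu>)"

definition rate_K :: "(real \<Rightarrow> ennreal) \<Rightarrow> real \<Rightarrow> ennreal" where
  "rate_K \<beta> u = (if u = 0 then 0 else ennreal u * \<beta> (1 / u))"

definition Kstar :: "(real \<Rightarrow> ennreal) \<Rightarrow> ereal \<Rightarrow> ereal" where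
  "Kstar \<beta> v = (SUP u\<in>{0..}. ereal u * v - enn2ereal (rate_K \<beta> u))"

text \<open>The standing normalisation of the rate functions.\<close>

definition normalised :: "(real \<Rightarrow> ennreal) \<Rightarrow> bool" where
  "normalised \<beta> \<longleftrightarrow> (\<forall>v\<in>{0..1/4}. Kstar \<beta> (ereal v) \<le> ereal v)"

end

theory Submission
  imports Defs
begin

text \<open>
  All operators are self-adjoint contractions of \<open>L\<^sup>2(\<Pi>)\<close>. Divide by the squared oscillation of \<open>f\<close>, put
  \<open>h = H\<^sub>2 f\<close> and write \<open>E\<close>, \<open>C\<close> for the Dirichlet forms of the projection \<open>G\<^sub>2\<close> at \<open>f\<close> and of \<open>G\<^sub>1\<close> at \<open>h\<close>,
  and \<open>A\<close>, \<open>B\<close> for the losses of squared norm from \<open>f\<close> to \<open>h\<close> and from \<open>h\<close> to \<open>H\<^sub>1 h\<close>, so that the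
  quantity to be bounded below is \<open>A + B\<close>. Integrating the conditional inequalities and using
  \<open>H\<^sub>i\<^sup>2 \<le> H\<^sub>i\<close> gives \<open>K\<^sub>2\<^sup>*(E) \<le> A\<close> and \<open>K\<^sub>1\<^sup>*(C) \<le> B\<close>. From \<open>H\<^sub>2 G\<^sub>2 = G\<^sub>2\<close> and the parallelogram law,
  the Dirichlet form of \<open>P\<^sup>* P\<close> at \<open>f\<close> is at most \<open>2 C + 3 E\<close>, hence \<open>K\<^sub>0\<^sup>*(v/4) \<le> K\<^sub>0\<^sup>*(v)/4 \<le> C + E\<close>.
  The functions \<open>K\<^sub>i\<^sup>*\<close> are convex and increasing, and \<open>C\<close>, \<open>A\<close> lie in \<open>[0, 1/4]\<close>, where the normalisation gives
  \<open>K\<^sub>2\<^sup>*(C) \<le> C\<close> and \<open>K\<^sub>1\<^sup>*(A) \<le> A\<close>. Therefore \<open>K\<^sub>2\<^sup>*((E + C)/2) \<le> (A + C)/2\<close> and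
  \<open>K\<^sub>1\<^sup>*((A + C)/2) \<le> (A + B)/2\<close>.
\<close>

section \<open>Integration against a kernel\<close>

text \<open>Only integrability against the mixture is known, so single kernels may fail to integrate
  \<open>f\<close> on a null set. By the nonnegative bind formula the integrals \<open>A\<close> and
  \<open>C\<close> of the positive and negative parts have finite mean, hence are finite almost
  everywhere and may be subtracted.\<close>

lemma integral_bind_prob:
  fixes f :: "'b \<Rightarrow> real"
  assumes M: "space M \<noteq> {}" and K: "K \<in> M \<rightarrow>\<^sub>M prob_algebra B" and f: "integrable (M \<bind> K) f"
  shows AE_integrable_bind: "AE x in M. integrable (K x) f"
    and integrable_integral_bind: "integrable M (\<lambda>x. \<integral>y. f y \<partial>K x)"
    and integral_integral_bind: "(\<integral>x. (\<integral>y. f y \<partial>K x) \<partial>M) = (\<integral>y. f y \<partial>(M \<bind> K))"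
proof -
  have Ks[measurable]: "K \<in> M \<rightarrow>\<^sub>M subprob_algebra B"
    using K by (rule measurable_prob_algebraD)
  have sB: "sets (M \<bind> K) = sets B"
    by (rule sets_bind[OF sets_kernel[OF Ks] M])
  have fB[measurable]: "f \<in> borel_measurable B"
    using borel_measurable_integrable[OF f] by (simp cong: measurable_cong_sets add: measurable_cong_sets[OF sB refl])
  have fK: "f \<in> borel_measurable (K x)" if "x \<in> space M" for x
    using fB sets_kernel[OF Ks that] by (simp cong: measurable_cong_sets)
  have meas[measurable]: "(\<lambda>x. \<integral>\<^sup>+y. ennreal (g y) \<partial>K x) \<in> borel_measurable M"
    if "g \<in> borel_measurable B" for g :: "'b \<Rightarrow> real"
    using that by (intro measurable_compose[OF Ks nn_integral_measurable_subprob_algebra]) simp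
  have mI[measurable]: "(\<lambda>x. \<integral>y. f y \<partial>K x) \<in> borel_measurable M"
    by (intro measurable_compose[OF Ks integral_measurable_subprob_algebra]) simp
  have nn: "(\<integral>\<^sup>+x. (\<integral>\<^sup>+y. ennreal (g y) \<partial>K x) \<partial>M) = (\<integral>\<^sup>+y. ennreal (g y) \<partial>(M \<bind> K))"
    if "g \<in> borel_measurable B" for g
    using that by (subst nn_integral_bind[where B=B]) auto
  define A where "A = (\<lambda>x. \<integral>\<^sup>+y. ennreal (f y) \<partial>K x)"
  define C where "C = (\<lambda>x. \<integral>\<^sup>+y. ennreal (- f y) \<partial>K x)"
  have [measurable]: "A \<in> borel_measurable M" "C \<in> borel_measurable M"
    unfolding A_def C_def by measurable
  have intA: "(\<integral>\<^sup>+x. A x \<partial>M) = (\<integral>\<^sup>+y. ennreal (f y) \<partial>(M \<bind> K))"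
    and intC: "(\<integral>\<^sup>+x. C x \<partial>M) = (\<integral>\<^sup>+y. ennreal (- f y) \<partial>(M \<bind> K))"
    unfolding A_def C_def by (intro nn; measurable)+
  have finA: "(\<integral>\<^sup>+x. A x \<partial>M) \<noteq> \<infinity>" and finC: "(\<integral>\<^sup>+x. C x \<partial>M) \<noteq> \<infinity>"
    unfolding intA intC using f by (auto simp: real_integrable_def)
  have aeA: "AE x in M. A x \<noteq> \<infinity>" and aeC: "AE x in M. C x \<noteq> \<infinity>"
    using nn_integral_PInf_AE[OF _ finA] nn_integral_PInf_AE[OF _ finC] by auto
  show 1: "AE x in M. integrable (K x) f"
    using aeA aeC AE_space
    by eventually_elim (auto simp: real_integrable_def A_def C_def fK)
  have eq: "AE x in M. (\<integral>y. f y \<partial>K x) = enn2real (A x) - enn2real (C x)"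
    using 1 by eventually_elim (simp add: real_lebesgue_integral_def A_def C_def)
  have eA: "AE x in M. ennreal (enn2real (A x)) = A x" using aeA
    by eventually_elim (simp add: ennreal_enn2real top.not_eq_extremum)
  have eC: "AE x in M. ennreal (enn2real (C x)) = C x" using aeC
    by eventually_elim (simp add: ennreal_enn2real top.not_eq_extremum)
  have nA: "(\<integral>\<^sup>+x. ennreal (enn2real (A x)) \<partial>M) = (\<integral>\<^sup>+x. A x \<partial>M)"
    using eA by (rule nn_integral_cong_AE)
  have nC: "(\<integral>\<^sup>+x. ennreal (enn2real (C x)) \<partial>M) = (\<integral>\<^sup>+x. C x \<partial>M)"
    using eC by (rule nn_integral_cong_AE)
  have iA: "integrable M (\<lambda>x. enn2real (A x))"
    using finA nA by (intro integrableI_nonneg) (auto simp: less_top)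
  have iC: "integrable M (\<lambda>x. enn2real (C x))"
    using finC nC by (intro integrableI_nonneg) (auto simp: less_top)
  have "integrable M (\<lambda>x. enn2real (A x) - enn2real (C x))"
    using iA iC by auto
  then show "integrable M (\<lambda>x. \<integral>y. f y \<partial>K x)"
    using eq by (subst integrable_cong_AE) auto
  have "(\<integral>x. (\<integral>y. f y \<partial>K x) \<partial>M) = (\<integral>x. enn2real (A x) - enn2real (C x) \<partial>M)"
    using eq by (intro integral_cong_AE) auto
  also have "\<dots> = (\<integral>x. enn2real (A x) \<partial>M) - (\<integral>x. enn2real (C x) \<partial>M)"
    using iA iC by (rule Bochner_Integration.integral_diff)
  also have "\<dots> = enn2real (\<integral>\<^sup>+x. A x \<partial>M) - enn2real (\<integral>\<^sup>+x. C x \<partial>M)"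
    by (simp add: integral_eq_nn_integral nA nC)
  also have "\<dots> = (\<integral>y. f y \<partial>(M \<bind> K))"
    using f by (simp add: real_lebesgue_integral_def intA intC)
  finally show "(\<integral>x. (\<integral>y. f y \<partial>K x) \<partial>M) = (\<integral>y. f y \<partial>(M \<bind> K))" .
qed

text \<open>The joint law of \<open>(x, y)\<close> with \<open>x\<close> drawn from \<open>M\<close>
  and then \<open>y\<close> from \<open>K x\<close>; \<open>N\<close> supplies the sigma-algebra of
  the second coordinate.\<close>

definition semidirect :: "'a measure \<Rightarrow> ('a \<Rightarrow> 'b measure) \<Rightarrow> 'b measure \<Rightarrow> ('a \<times> 'b) measure" where
  "semidirect M K N = M \<bind> (\<lambda>x. distr (K x) (M \<Otimes>\<^sub>M N) (Pair x))"

lemma measurable_semidirect_kernel: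
  assumes "K \<in> M \<rightarrow>\<^sub>M prob_algebra N"
  shows "(\<lambda>x. distr (K x) (M \<Otimes>\<^sub>M N) (Pair x)) \<in> M \<rightarrow>\<^sub>M prob_algebra (M \<Otimes>\<^sub>M N)"
  using assms by measurable

lemma sets_semidirect[measurable_cong]:
  assumes M: "prob_space M"
  shows "sets (semidirect M K N) = sets (M \<Otimes>\<^sub>M N)"
  unfolding semidirect_def using prob_space.not_empty[OF M]
  by (intro sets_bind) auto

lemma emeasure_semidirect_Times:
  assumes M: "prob_space M" and K[measurable]: "K \<in> M \<rightarrow>\<^sub>M prob_algebra N"
    and A[measurable]: "A \<in> sets M" and B[measurable]: "B \<in> sets N"
  shows "emeasure (semidirect M K N) (A \<times> B) = (\<integral>\<^sup>+x\<in>A. emeasure (K x) B \<partial>M)"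
proof -
  have Ks: "K \<in> M \<rightarrow>\<^sub>M subprob_algebra N"
    using K by (rule measurable_prob_algebraD)
  have "emeasure (semidirect M K N) (A \<times> B)
      = (\<integral>\<^sup>+x. emeasure (distr (K x) (M \<Otimes>\<^sub>M N) (Pair x)) (A \<times> B) \<partial>M)"
    unfolding semidirect_def using prob_space.not_empty[OF M]
    by (intro emeasure_bind[where N="M \<Otimes>\<^sub>M N"] measurable_prob_algebraD measurable_semidirect_kernel) auto
  also have "\<dots> = (\<integral>\<^sup>+x\<in>A. emeasure (K x) B \<partial>M)"
  proof (intro nn_integral_cong)
    fix x assume x: "x \<in> space M"
    have s: "sets (K x) = sets N" using sets_kernel[OF Ks x] .
    have "emeasure (distr (K x) (M \<Otimes>\<^sub>M N) (Pair x)) (A \<times> B)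
        = emeasure (K x) (Pair x -` (A \<times> B) \<inter> space (K x))"
      using x s by (intro emeasure_distr) (auto simp: measurable_cong_sets[OF s refl])
    also have "Pair x -` (A \<times> B) \<inter> space (K x) = (if x \<in> A then B else {})"
      using s sets.sets_into_space[OF B] by (auto dest: sets_eq_imp_space_eq)
    finally show "emeasure (distr (K x) (M \<Otimes>\<^sub>M N) (Pair x)) (A \<times> B) = emeasure (K x) B * indicator A x"
      by auto
  qed
  finally show ?thesis .
qed

text \<open>Measurable rectangles form an intersection-stable generator and the whole space has
  finite mass, so the values on rectangles determine the measure.\<close>

lemma semidirect_eqI:
  assumes M: "prob_space M" and K: "K \<in> M \<rightarrow>\<^sub>M prob_algebra N"
    and L: "finite_measure L" "sets L = sets (M \<Otimes>\<^sub>M N)"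
    and eq: "\<And>A B. A \<in> sets M \<Longrightarrow> B \<in> sets N \<Longrightarrow>
      emeasure L (A \<times> B) = (\<integral>\<^sup>+x\<in>A. emeasure (K x) B \<partial>M)"
  shows "L = semidirect M K N"
proof (rule measure_eqI_generator_eq[OF Int_stable_pair_measure_generator[of M N]])
  show "{a \<times> b |a b. a \<in> sets M \<and> b \<in> sets N} \<subseteq> Pow (space M \<times> space N)"
    by (rule pair_measure_closed)
  show "emeasure L X = emeasure (semidirect M K N) X"
    if X: "X \<in> {a \<times> b |a b. a \<in> sets M \<and> b \<in> sets N}" for X
  proof -
    from X obtain A B where AB: "X = A \<times> B" "A \<in> sets M" "B \<in> sets N" by blast
    show ?thesis
      unfolding AB(1) eq[OF AB(2,3)] emeasure_semidirect_Times[OF M K AB(2,3)] ..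
  qed
  show "sets L = sigma_sets (space M \<times> space N) {a \<times> b |a b. a \<in> sets M \<and> b \<in> sets N}"
    by (simp add: L sets_pair_measure)
  show "sets (semidirect M K N) = sigma_sets (space M \<times> space N) {a \<times> b |a b. a \<in> sets M \<and> b \<in> sets N}"
    by (simp add: sets_semidirect[OF M] sets_pair_measure)
  show "range (\<lambda>_::nat. space M \<times> space N) \<subseteq> {a \<times> b |a b. a \<in> sets M \<and> b \<in> sets N}"
    by auto
  show "(\<Union>i::nat. space M \<times> space N) = space M \<times> space N" by simp
  show "emeasure L (space M \<times> space N) \<noteq> \<infinity>" for i :: nat
    using finite_measure.emeasure_finite[OF L(1)] by simp
qed

lemma nn_integral_semidirect:
  assumes M: "prob_space M" and K: "K \<in> M \<rightarrow>\<^sub>M prob_algebra N"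
    and f: "f \<in> borel_measurable (M \<Otimes>\<^sub>M N)"
  shows "(\<integral>\<^sup>+z. f z \<partial>semidirect M K N) = (\<integral>\<^sup>+x. (\<integral>\<^sup>+y. f (x, y) \<partial>K x) \<partial>M)"
proof -
  have Ks: "K \<in> M \<rightarrow>\<^sub>M subprob_algebra N"
    using K by (rule measurable_prob_algebraD)
  have "(\<integral>\<^sup>+z. f z \<partial>semidirect M K N) = (\<integral>\<^sup>+x. (\<integral>\<^sup>+z. f z \<partial>distr (K x) (M \<Otimes>\<^sub>M N) (Pair x)) \<partial>M)"
    unfolding semidirect_def
    by (rule nn_integral_bind[OF f measurable_prob_algebraD[OF measurable_semidirect_kernel[OF K]]])
  also have "\<dots> = (\<integral>\<^sup>+x. (\<integral>\<^sup>+y. f (x, y) \<partial>K x) \<partial>M)"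
  proof (rule nn_integral_cong)
    fix x assume x: "x \<in> space M"
    have "Pair x \<in> K x \<rightarrow>\<^sub>M M \<Otimes>\<^sub>M N"
      using x sets_kernel[OF Ks x] by (simp cong: measurable_cong_sets)
    from nn_integral_distr[OF this, of f] f
    show "(\<integral>\<^sup>+z. f z \<partial>distr (K x) (M \<Otimes>\<^sub>M N) (Pair x)) = (\<integral>\<^sup>+y. f (x, y) \<partial>K x)"
      by simp
  qed
  finally show ?thesis .
qed

lemma integral_semidirect:
  fixes f :: "'a \<Rightarrow> 'b \<Rightarrow> real"
  assumes M: "prob_space M" and K: "K \<in> M \<rightarrow>\<^sub>M prob_algebra N"
    and f: "integrable (semidirect M K N) (\<lambda>(x, y). f x y)"
  shows AE_integrable_semidirect: "AE x in M. integrable (K x) (f x)"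
    and integrable_integral_semidirect: "integrable M (\<lambda>x. \<integral>y. f x y \<partial>K x)"
    and integral_integral_semidirect:
      "(\<integral>x. (\<integral>y. f x y \<partial>K x) \<partial>M) = (\<integral>z. f (fst z) (snd z) \<partial>semidirect M K N)"
proof -
  note ne = prob_space.not_empty[OF M]
  note K' = measurable_semidirect_kernel[OF K]
  have Ks: "K \<in> M \<rightarrow>\<^sub>M subprob_algebra N"
    using K by (rule measurable_prob_algebraD)
  have fm: "(\<lambda>(x, y). f x y) \<in> borel_measurable (M \<Otimes>\<^sub>M N)"
    using borel_measurable_integrable[OF f] by (simp add: measurable_cong_sets[OF sets_semidirect[OF M] refl])
  have P: "Pair x \<in> K x \<rightarrow>\<^sub>M M \<Otimes>\<^sub>M N" if "x \<in> space M" for x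
    using that sets_kernel[OF Ks that] by (simp cong: measurable_cong_sets)
  note 1 = integral_bind_prob[OF ne K' f[unfolded semidirect_def]]
  have i: "integrable (distr (K x) (M \<Otimes>\<^sub>M N) (Pair x)) (\<lambda>(x, y). f x y) = integrable (K x) (f x)"
    if "x \<in> space M" for x
    by (simp add: integrable_distr_eq[OF P[OF that] fm])
  have e: "(\<integral>y. (case y of (x, y) \<Rightarrow> f x y) \<partial>distr (K x) (M \<Otimes>\<^sub>M N) (Pair x)) = (\<integral>y. f x y \<partial>K x)"
    if "x \<in> space M" for x
    by (simp add: integral_distr[OF P[OF that] fm])
  show "AE x in M. integrable (K x) (f x)"
    using 1(1) by (rule AE_mp) (auto intro!: AE_I2 simp: i)
  show "integrable M (\<lambda>x. \<integral>y. f x y \<partial>K x)"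
    using 1(2) by (simp add: e cong: Bochner_Integration.integrable_cong)
  have "(\<integral>x. (\<integral>y. f x y \<partial>K x) \<partial>M)
      = (\<integral>x. (\<integral>y. (case y of (x, y) \<Rightarrow> f x y) \<partial>distr (K x) (M \<Otimes>\<^sub>M N) (Pair x)) \<partial>M)"
    by (rule Bochner_Integration.integral_cong) (auto simp: e)
  then show "(\<integral>x. (\<integral>y. f x y \<partial>K x) \<partial>M) = (\<integral>z. f (fst z) (snd z) \<partial>semidirect M K N)"
    using 1(3) by (simp add: semidirect_def split_beta)
qed

text \<open>\<open>Q\<close> need not be measurable, so its exceptional set is first enlarged to a
  measurable null set \<open>S\<close>, which is then sliced.\<close>

lemma AE_semidirect:
  assumes M: "prob_space M" and K: "K \<in> M \<rightarrow>\<^sub>M prob_algebra N"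
    and ae: "AE z in semidirect M K N. Q z"
  shows "AE x in M. AE y in K x. Q (x, y)"
proof -
  have Ks: "K \<in> M \<rightarrow>\<^sub>M subprob_algebra N"
    using K by (rule measurable_prob_algebraD)
  note K' = measurable_prob_algebraD[OF measurable_semidirect_kernel[OF K]]
  note ss = sets_semidirect[OF M, of K N]
  obtain S where S: "{z \<in> space (semidirect M K N). \<not> Q z} \<subseteq> S" "S \<in> null_sets (semidirect M K N)"
    using ae by (auto simp: eventually_ae_filter)
  have Sm[measurable]: "S \<in> sets (M \<Otimes>\<^sub>M N)" using S(2) ss by auto
  have "AE z in semidirect M K N. z \<notin> S" using S(2) by (rule AE_not_in)
  then have "AE x in M. AE z in distr (K x) (M \<Otimes>\<^sub>M N) (Pair x). z \<notin> S"
    unfolding semidirect_def by (subst (asm) AE_bind[OF K']) auto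
  then show ?thesis
    using AE_space
  proof eventually_elim
    fix x assume x: "x \<in> space M" and a: "AE z in distr (K x) (M \<Otimes>\<^sub>M N) (Pair x). z \<notin> S"
    have P: "Pair x \<in> K x \<rightarrow>\<^sub>M M \<Otimes>\<^sub>M N"
      using x sets_kernel[OF Ks x] by (simp cong: measurable_cong_sets)
    have "AE y in K x. (x, y) \<notin> S"
      using a by (subst (asm) AE_distr_iff[OF P]) auto
    then show "AE y in K x. Q (x, y)"
      using AE_space
    proof eventually_elim
      fix y assume "y \<in> space (K x)" "(x, y) \<notin> S"
      moreover have "space (semidirect M K N) = space M \<times> space (K x)"
        using sets_eq_imp_space_eq[OF ss] sets_eq_imp_space_eq[OF sets_kernel[OF Ks x]]
        by (simp add: space_pair_measure)
      ultimately show "Q (x, y)" using S(1) x by auto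
    qed
  qed
qed

section \<open>Reversible kernels on \<open>L\<^sup>2\<close>\<close>

text \<open>Operators act on functions, and the default value 0 of divergent kernel integrals breaks
  pointwise additivity. Symmetry takes its place: \<open>T\<close> is moved to the other argument of
  the inner product, where sums can be expanded.\<close>

definition symmetric_contraction :: "'a measure \<Rightarrow> (('a \<Rightarrow> real) \<Rightarrow> 'a \<Rightarrow> real) \<Rightarrow> bool" where
  "symmetric_contraction M T \<longleftrightarrow> (\<forall>f\<in>L2 M. T f \<in> L2 M) \<and>
     (\<forall>f\<in>L2 M. \<forall>g\<in>L2 M. L2_inner M (T f) g = L2_inner M f (T g)) \<and>
     (\<forall>f\<in>L2 M. L2_inner M (T f) (T f) \<le> L2_inner M f f)"

lemma L2_mult_integrable:
  assumes "f \<in> L2 M" "g \<in> L2 M"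
  shows "integrable M (\<lambda>x. f x * g x)"
proof (rule Bochner_Integration.integrable_bound)
  show "integrable M (\<lambda>x. (f x)\<^sup>2 + (g x)\<^sup>2)"
    using assms by (auto simp: L2_def)
  show "(\<lambda>x. f x * g x) \<in> borel_measurable M"
    using assms by (auto simp: L2_def)
  have "\<bar>a * b\<bar> \<le> a\<^sup>2 + b\<^sup>2" for a b :: real
    using sum_squares_bound[of "\<bar>a\<bar>" "\<bar>b\<bar>"] mult_nonneg_nonneg[OF abs_ge_zero abs_ge_zero, of a b]
    unfolding abs_mult power2_abs by linarith
  then show "AE x in M. norm (f x * g x) \<le> norm ((f x)\<^sup>2 + (g x)\<^sup>2)"
    by (intro AE_I2) simp
qed

lemma L2_integrable:
  assumes "prob_space M" "f \<in> L2 M"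
  shows "integrable M f"
proof -
  have "f \<in> borel_measurable M" "integrable M (\<lambda>x. (f x)\<^sup>2)"
    using assms(2) by (simp_all add: L2_def)
  then show ?thesis
    by (rule finite_measure.square_integrable_imp_integrable[OF prob_space.finite_measure[OF assms(1)]])
qed

lemma L2_add:
  assumes "f \<in> L2 M" "g \<in> L2 M"
  shows "(\<lambda>x. f x + g x) \<in> L2 M"
proof -
  have "integrable M (\<lambda>x. (f x)\<^sup>2 + (g x)\<^sup>2 + 2 * (f x * g x))"
    using assms L2_mult_integrable[OF assms]
    by (intro Bochner_Integration.integrable_add integrable_mult_right) (simp_all add: L2_def)
  then show ?thesis
    using assms by (auto simp: L2_def power2_sum mult.assoc)
qed

lemma L2_diff:
  assumes "f \<in> L2 M" "g \<in> L2 M"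
  shows "(\<lambda>x. f x - g x) \<in> L2 M"
proof -
  have "integrable M (\<lambda>x. (f x)\<^sup>2 + (g x)\<^sup>2 - 2 * (f x * g x))"
    using assms L2_mult_integrable[OF assms]
    by (intro Bochner_Integration.integrable_add Bochner_Integration.integrable_diff integrable_mult_right)
       (simp_all add: L2_def)
  then show ?thesis
    using assms by (auto simp: L2_def power2_diff mult.assoc)
qed

lemma (in prob_space) expectation_power2_le:
  fixes f :: "'a \<Rightarrow> real"
  assumes "f \<in> borel_measurable M" "integrable M (\<lambda>x. (f x)\<^sup>2)"
  shows "(expectation f)\<^sup>2 \<le> expectation (\<lambda>x. (f x)\<^sup>2)"
proof -
  have "0 \<le> variance f" by simp
  also have "variance f = expectation (\<lambda>x. (f x)\<^sup>2) - (expectation f)\<^sup>2"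
    using square_integrable_imp_integrable[OF assms] assms by (intro variance_eq)
  finally show ?thesis by simp
qed

locale reversible_kernel = prob_space M for M :: "'a measure" +
  fixes K :: "'a \<Rightarrow> 'a measure"
  assumes K: "K \<in> M \<rightarrow>\<^sub>M prob_algebra M" and rev: "reversible M K"
begin

lemmas Ks = measurable_prob_algebraD[OF K]

section \<open>The joint law of one stationary step\<close>

abbreviation "J \<equiv> semidirect M K M"

lemma prob_K: "x \<in> space M \<Longrightarrow> prob_space (K x)" and sets_K: "x \<in> space M \<Longrightarrow> sets (K x) = sets M"
  using measurable_space[OF K] by (auto simp: space_prob_algebra)

lemma space_K: "x \<in> space M \<Longrightarrow> space (K x) = space M"
  using sets_K by (rule sets_eq_imp_space_eq)

lemma sets_J[measurable_cong]: "sets J = sets (M \<Otimes>\<^sub>M M)"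
  by (rule sets_semidirect) unfold_locales

lemma space_J: "space J = space M \<times> space M"
  using sets_eq_imp_space_eq[OF sets_J] by (simp add: space_pair_measure)

lemma prob_J: "prob_space J"
  unfolding semidirect_def
  by (rule prob_space_bind'[OF _ measurable_semidirect_kernel[OF K]])
     (auto simp: space_prob_algebra prob_space_axioms)

lemma emeasure_J: "A \<in> sets M \<Longrightarrow> B \<in> sets M \<Longrightarrow> emeasure J (A \<times> B) = (\<integral>\<^sup>+x\<in>A. emeasure (K x) B \<partial>M)"
  by (rule emeasure_semidirect_Times[OF prob_space_axioms K])

lemma measurable_swap_J[measurable]: "prod.swap \<in> J \<rightarrow>\<^sub>M M \<Otimes>\<^sub>M M"
proof -
  have *: "prod.swap = (\<lambda>p. (snd p, fst p))" by auto
  show ?thesis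
    unfolding * measurable_cong_sets[OF sets_J refl] by simp
qed

text \<open>Detailed balance is exactly the equality of the two measures on rectangles.\<close>

lemma distr_J_swap: "distr J (M \<Otimes>\<^sub>M M) prod.swap = J"
proof (rule semidirect_eqI[OF prob_space_axioms K])
  show "finite_measure (distr J (M \<Otimes>\<^sub>M M) prod.swap)"
    by (intro prob_space.finite_measure prob_space.prob_space_distr prob_J) measurable
  fix A B assume A: "A \<in> sets M" and B: "B \<in> sets M"
  have "emeasure (distr J (M \<Otimes>\<^sub>M M) prod.swap) (A \<times> B) = emeasure J (prod.swap -` (A \<times> B) \<inter> space J)"
    using A B by (intro emeasure_distr) auto
  also have "prod.swap -` (A \<times> B) \<inter> space J = B \<times> A"
    using sets.sets_into_space[OF A] sets.sets_into_space[OF B] by (auto simp: space_J)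
  finally show "emeasure (distr J (M \<Otimes>\<^sub>M M) prod.swap) (A \<times> B) = (\<integral>\<^sup>+x\<in>A. emeasure (K x) B \<partial>M)"
    using A B rev by (simp add: emeasure_J reversible_def)
qed simp

lemma distr_J_fst: "distr J M fst = M"
proof (rule measure_eqI)
  fix A assume "A \<in> sets (distr J M fst)"
  then have A: "A \<in> sets M" by simp
  have "emeasure (distr J M fst) A = emeasure J (fst -` A \<inter> space J)"
    using A by (intro emeasure_distr) auto
  also have "fst -` A \<inter> space J = A \<times> space M"
    using sets.sets_into_space[OF A] by (auto simp: space_J)
  also have "emeasure J (A \<times> space M) = (\<integral>\<^sup>+x\<in>A. emeasure (K x) (space M) \<partial>M)"
    using A by (intro emeasure_J) auto
  also have "\<dots> = (\<integral>\<^sup>+x\<in>A. 1 \<partial>M)"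
    using prob_space.emeasure_space_1[OF prob_K] space_K
    by (intro nn_integral_cong) auto
  also have "\<dots> = emeasure M A" using A by simp
  finally show "emeasure (distr J M fst) A = emeasure M A" .
qed simp

text \<open>Reversibility implies invariance: the swap, which preserves \<open>J\<close>, exchanges
  the two marginals, and the first one is \<open>M\<close>.\<close>

lemma distr_J_snd: "distr J M snd = M"
proof -
  have "distr J M snd = distr (distr J (M \<Otimes>\<^sub>M M) prod.swap) M snd"
    by (simp add: distr_J_swap)
  also have "\<dots> = distr J M (snd \<circ> prod.swap)"
    by (rule distr_distr) auto
  also have "snd \<circ> prod.swap = fst" by auto
  finally show ?thesis by (simp add: distr_J_fst)
qed

lemma integrable_J_fst: "integrable M f \<Longrightarrow> integrable J (\<lambda>z. f (fst z))"
  for f :: "'a \<Rightarrow> real"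
  using integrable_distr[of fst J M f] by (simp add: distr_J_fst)

lemma integrable_J_snd: "integrable M f \<Longrightarrow> integrable J (\<lambda>z. f (snd z))"
  for f :: "'a \<Rightarrow> real"
  using integrable_distr[of snd J M f] by (simp add: distr_J_snd)

lemma integral_J_snd: "f \<in> borel_measurable M \<Longrightarrow> (\<integral>z. f (snd z) \<partial>J) = (\<integral>x. f x \<partial>M)"
  for f :: "'a \<Rightarrow> real"
  using integral_distr[of snd J M f] by (simp add: distr_J_snd)

text \<open>The second coordinate has law \<open>M\<close> under \<open>J\<close>, so a null set of
  \<open>M\<close> is entered in one step with probability zero.\<close>

lemma AE_AE_kernel:
  assumes "AE x in M. Q x"
  shows "AE x in M. AE y in K x. Q y"
proof -
  have "AE z in J. Q (snd z)"
    
  proof (rule AE_distrD[where f=snd and M=J and M'=M])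
    show "snd \<in> J \<rightarrow>\<^sub>M M" by simp
    show "AE z in distr J M snd. Q z" unfolding distr_J_snd by fact
  qed
  from AE_semidirect[OF prob_space_axioms K this] show ?thesis by simp
qed

section \<open>The kernel operator on square-integrable functions\<close>

lemma measurable_kernel_op[measurable]:
  "f \<in> borel_measurable M \<Longrightarrow> kernel_op K f \<in> borel_measurable M"
  unfolding kernel_op_def
  by (rule measurable_compose[OF Ks integral_measurable_subprob_algebra])

lemma AE_integrable_power2:
  assumes f: "f \<in> L2 M"
  shows "AE x in M. integrable (K x) (\<lambda>y. (f y)\<^sup>2)"
    and "integrable M (\<lambda>x. \<integral>y. (f y)\<^sup>2 \<partial>K x)"
    and "(\<integral>x. (\<integral>y. (f y)\<^sup>2 \<partial>K x) \<partial>M) = (\<integral>x. (f x)\<^sup>2 \<partial>M)"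
proof -
  have i: "integrable M (\<lambda>x. (f x)\<^sup>2)" using f by (simp add: L2_def)
  then have "integrable J (\<lambda>(x, y). (f y)\<^sup>2)"
    using integrable_J_snd[OF i] by (simp add: case_prod_unfold)
  note * = integral_semidirect[OF prob_space_axioms K this]
  show "AE x in M. integrable (K x) (\<lambda>y. (f y)\<^sup>2)"
    and "integrable M (\<lambda>x. \<integral>y. (f y)\<^sup>2 \<partial>K x)"
    using * by auto
  show "(\<integral>x. (\<integral>y. (f y)\<^sup>2 \<partial>K x) \<partial>M) = (\<integral>x. (f x)\<^sup>2 \<partial>M)"
    using *(3) integral_J_snd[of "\<lambda>x. (f x)\<^sup>2"] i by simp
qed

lemma AE_L2_kernel:
  assumes f: "f \<in> L2 M"
  shows "AE x in M. f \<in> L2 (K x)"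
  using AE_integrable_power2(1)[OF f] AE_space
proof eventually_elim
  case (elim x)
  then show ?case using f by (simp add: L2_def measurable_cong_sets[OF sets_K refl])
qed

lemma AE_power2_kernel_op_le:
  assumes f: "f \<in> L2 M"
  shows "AE x in M. (kernel_op K f x)\<^sup>2 \<le> (\<integral>y. (f y)\<^sup>2 \<partial>K x)"
  using AE_L2_kernel[OF f] AE_space
proof eventually_elim
  case (elim x)
  then interpret K: prob_space "K x" using prob_K by simp
  show ?case
    unfolding kernel_op_def using elim by (intro K.expectation_power2_le) (auto simp: L2_def)
qed

lemma kernel_op_L2:
  assumes f: "f \<in> L2 M"
  shows "kernel_op K f \<in> L2 M"
proof -
  have [measurable]: "f \<in> borel_measurable M" using f by (simp add: L2_def)
  have "integrable M (\<lambda>x. (kernel_op K f x)\<^sup>2)"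
  proof (rule Bochner_Integration.integrable_bound[OF AE_integrable_power2(2)[OF f]])
    show "AE x in M. norm ((kernel_op K f x)\<^sup>2) \<le> norm (\<integral>y. (f y)\<^sup>2 \<partial>K x)"
      using AE_power2_kernel_op_le[OF f] by eventually_elim auto
  qed measurable
  then show ?thesis by (simp add: L2_def)
qed

text \<open>Jensen's inequality bounds the squared average by the average of the square, and by
  invariance the latter has the same integral as the square itself.\<close>

lemma kernel_op_contraction:
  assumes f: "f \<in> L2 M"
  shows "L2_inner M (kernel_op K f) (kernel_op K f) \<le> L2_inner M f f"
proof -
  have "(\<integral>x. (kernel_op K f x)\<^sup>2 \<partial>M) \<le> (\<integral>x. (f x)\<^sup>2 \<partial>M)"
    unfolding AE_integrable_power2(3)[OF f, symmetric]
    using kernel_op_L2[OF f]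
    by (intro integral_mono_AE AE_integrable_power2(2)[OF f] AE_power2_kernel_op_le[OF f]) (simp add: L2_def)
  then show ?thesis
    by (simp add: L2_inner_def power2_eq_square)
qed

text \<open>Over \<open>J\<close>, exchanging \<open>f\<close> and \<open>g\<close> amounts to
  swapping the coordinates; this representation yields the symmetry of the operator.\<close>

lemma kernel_op_eq_integral_J:
  assumes f: "f \<in> L2 M" and g: "g \<in> L2 M"
  shows "L2_inner M (kernel_op K f) g = (\<integral>z. g (fst z) * f (snd z) \<partial>J)"
proof -
  have *: "(\<lambda>z. h (fst z)) \<in> L2 J" "(\<lambda>z. h (snd z)) \<in> L2 J" if "h \<in> L2 M" for h
    using that integrable_J_fst[of "\<lambda>x. (h x)\<^sup>2"] integrable_J_snd[of "\<lambda>x. (h x)\<^sup>2"]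
    by (auto simp: L2_def)
  have "integrable J (\<lambda>(x, y). g x * f y)"
    using L2_mult_integrable[OF *(1)[OF g] *(2)[OF f]] by (simp add: case_prod_unfold)
  from integral_semidirect(3)[OF prob_space_axioms K this] show ?thesis
    by (simp add: L2_inner_def kernel_op_def mult.commute)
qed

lemma kernel_op_symmetric:
  assumes f: "f \<in> L2 M" and g: "g \<in> L2 M"
  shows "L2_inner M (kernel_op K f) g = L2_inner M f (kernel_op K g)"
proof -
  have [measurable]: "f \<in> borel_measurable M" "g \<in> borel_measurable M"
    using f g by (auto simp: L2_def)
  have "(\<integral>z. g (fst z) * f (snd z) \<partial>J) = (\<integral>z. g (fst z) * f (snd z) \<partial>distr J (M \<Otimes>\<^sub>M M) prod.swap)"
    by (simp add: distr_J_swap)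
  also have "\<dots> = (\<integral>z. g (fst (prod.swap z)) * f (snd (prod.swap z)) \<partial>J)"
    by (rule integral_distr) auto
  also have "\<dots> = (\<integral>z. f (fst z) * g (snd z) \<partial>J)"
    by (simp add: mult.commute)
  finally show ?thesis
    using kernel_op_eq_integral_J[OF f g] kernel_op_eq_integral_J[OF g f]
    by (simp add: L2_inner_def mult.commute)
qed

lemma symmetric_contraction_kernel_op: "symmetric_contraction M (kernel_op K)"
  unfolding symmetric_contraction_def
  using kernel_op_L2 kernel_op_symmetric kernel_op_contraction by auto

text \<open>A probability average respects an upper bound, and by invariance the exceptional null
  set is invisible to almost every \<open>K x\<close>. Applied also to \<open>- f\<close>, this
  shows that oscillation does not grow.\<close>

lemma kernel_op_AE_le:
  assumes f: "f \<in> L2 M" and c: "AE x in M. f x \<le> c"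
  shows "AE x in M. kernel_op K f x \<le> c"
  using AE_L2_kernel[OF f] AE_AE_kernel[OF c] AE_space
proof eventually_elim
  case (elim x)
  then interpret K: prob_space "K x" using prob_K by simp
  have "integrable (K x) f" using elim(1) by (rule L2_integrable[OF K.prob_space_axioms])
  then show ?case
    unfolding kernel_op_def using elim(2) by (rule K.integral_le_const)
qed

end

section \<open>Dirichlet forms\<close>

lemma L2_inner_commute: "L2_inner M f g = L2_inner M g f"
  by (simp add: L2_inner_def mult.commute)

lemma L2_inner_add_left:
  assumes "f \<in> L2 M" "g \<in> L2 M" "h \<in> L2 M"
  shows "L2_inner M (\<lambda>x. f x + g x) h = L2_inner M f h + L2_inner M g h"
  using L2_mult_integrable[OF assms(1,3)] L2_mult_integrable[OF assms(2,3)]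
  by (simp add: L2_inner_def distrib_right)

lemma L2_inner_diff_left:
  assumes "f \<in> L2 M" "g \<in> L2 M" "h \<in> L2 M"
  shows "L2_inner M (\<lambda>x. f x - g x) h = L2_inner M f h - L2_inner M g h"
  using L2_mult_integrable[OF assms(1,3)] L2_mult_integrable[OF assms(2,3)]
  by (simp add: L2_inner_def left_diff_distrib)

lemma L2_inner_add_right:
  assumes "f \<in> L2 M" "g \<in> L2 M" "h \<in> L2 M"
  shows "L2_inner M h (\<lambda>x. f x + g x) = L2_inner M h f + L2_inner M h g"
  using L2_inner_add_left[OF assms] by (simp add: L2_inner_commute)

lemma L2_inner_diff_right:
  assumes "f \<in> L2 M" "g \<in> L2 M" "h \<in> L2 M"
  shows "L2_inner M h (\<lambda>x. f x - g x) = L2_inner M h f - L2_inner M h g"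
  using L2_inner_diff_left[OF assms] by (simp add: L2_inner_commute)

lemma L2_inner_self_nonneg: "0 \<le> L2_inner M f f"
  by (simp add: L2_inner_def)

lemma symmetric_contractionD:
  assumes "symmetric_contraction M T"
  shows symmetric_contraction_L2: "f \<in> L2 M \<Longrightarrow> T f \<in> L2 M"
    and symmetric_contraction_symm:
      "f \<in> L2 M \<Longrightarrow> g \<in> L2 M \<Longrightarrow> L2_inner M (T f) g = L2_inner M f (T g)"
    and symmetric_contraction_le: "f \<in> L2 M \<Longrightarrow> L2_inner M (T f) (T f) \<le> L2_inner M f f"
  using assms by (auto simp: symmetric_contraction_def)

lemma dirichlet_form_eq:
  assumes "f \<in> L2 M" "T f \<in> L2 M"
  shows "dirichlet_form M T f = L2_inner M f f - L2_inner M (T f) f"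
  unfolding dirichlet_form_def using assms by (intro L2_inner_diff_left)

text \<open>Expand the squared norm of \<open>f - T f\<close>; by the contraction bound it is at
  most twice the Dirichlet form.\<close>

lemma dirichlet_form_nonneg:
  assumes T: "symmetric_contraction M T" and f: "f \<in> L2 M"
  shows "0 \<le> dirichlet_form M T f"
proof -
  note Tf = symmetric_contraction_L2[OF T f]
  have "0 \<le> L2_inner M (\<lambda>x. f x - T f x) (\<lambda>x. f x - T f x)"
    by (rule L2_inner_self_nonneg)
  also have "\<dots> = L2_inner M f f - 2 * L2_inner M (T f) f + L2_inner M (T f) (T f)"
    using f Tf L2_diff[OF f Tf]
    by (simp add: L2_inner_diff_left L2_inner_diff_right L2_inner_commute[of M f "T f"])
  finally show ?thesis
    using symmetric_contraction_le[OF T f] by (simp add: dirichlet_form_eq[where T=T, OF f Tf])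
qed

lemma dirichlet_form_le_norm:
  assumes "f \<in> L2 M" "T f \<in> L2 M" "0 \<le> L2_inner M (T f) f"
  shows "dirichlet_form M T f \<le> L2_inner M f f"
  using assms by (simp add: dirichlet_form_eq)

text \<open>For \<open>0 \<le> T \<le> I\<close> one has \<open>T - T\<^sup>2 = (I - T) T (I - T) + T (I - T) T \<ge> 0\<close>.\<close>

lemma dirichlet_form_le_square:
  assumes T: "symmetric_contraction M T" and pos: "\<And>f. f \<in> L2 M \<Longrightarrow> 0 \<le> L2_inner M (T f) f"
    and f: "f \<in> L2 M"
  shows "dirichlet_form M T f \<le> L2_inner M f f - L2_inner M (T f) (T f)"
proof -
  note Tf = symmetric_contraction_L2[OF T f]
  note TTf = symmetric_contraction_L2[OF T Tf]
  define g where "g = (\<lambda>x. f x - T f x)"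
  have g: "g \<in> L2 M" unfolding g_def using f Tf by (rule L2_diff)
  note Tg = symmetric_contraction_L2[OF T g]
  have "L2_inner M (T g) g = L2_inner M (T g) f - L2_inner M (T g) (T f)"
    unfolding g_def by (intro L2_inner_diff_right f Tf Tg[unfolded g_def])
  also have "\<dots> = L2_inner M g (T f) - L2_inner M g (T (T f))"
    by (simp add: symmetric_contraction_symm[OF T g] f Tf)
  also have "\<dots> = (L2_inner M f (T f) - L2_inner M (T f) (T f)) - (L2_inner M f (T (T f)) - L2_inner M (T f) (T (T f)))"
    unfolding g_def by (simp add: L2_inner_diff_left f Tf TTf)
  also have "L2_inner M f (T (T f)) = L2_inner M (T f) (T f)"
    by (simp add: symmetric_contraction_symm[OF T f Tf])
  finally have "0 \<le> L2_inner M f (T f) - L2_inner M (T f) (T f) - (L2_inner M (T f) (T f) - L2_inner M (T f) (T (T f)))"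
    using pos[OF g] by simp
  \<comment> \<open>The second summand \<open>T (I - T) T\<close> at \<open>f\<close> is the
    Dirichlet form at \<open>T f\<close>.\<close>
  moreover have "0 \<le> L2_inner M (T f) (T f) - L2_inner M (T f) (T (T f))"
    using dirichlet_form_nonneg[OF T Tf]
    by (simp add: dirichlet_form_eq[where T=T, OF Tf TTf] L2_inner_commute[of M "T f" "T (T f)"])
  ultimately show ?thesis
    by (simp add: dirichlet_form_eq[where T=T, OF f Tf] L2_inner_commute[of M f "T f"])
qed

text \<open>Parallelogram law: the forms at \<open>f + g\<close> and \<open>f - g\<close> sum to the
  right-hand side, and the form at \<open>f - g\<close> is nonnegative.\<close>

lemma dirichlet_form_add_le:
  assumes T: "symmetric_contraction M T" and f: "f \<in> L2 M" and g: "g \<in> L2 M"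
  shows "dirichlet_form M T (\<lambda>x. f x + g x) \<le> 2 * dirichlet_form M T f + 2 * dirichlet_form M T g"
proof -
  note Tf = symmetric_contraction_L2[OF T f] and Tg = symmetric_contraction_L2[OF T g]
  note fg = L2_add[OF f g] and fg' = L2_diff[OF f g]
  note L = f g Tf Tg fg fg' symmetric_contraction_L2[OF T fg] symmetric_contraction_L2[OF T fg']
  have 1: "L2_inner M (T (\<lambda>x. f x + g x)) (\<lambda>x. f x + g x)
      = L2_inner M f (T f) + L2_inner M g (T f) + (L2_inner M f (T g) + L2_inner M g (T g))"
    by (subst L2_inner_add_right) (simp_all add: L symmetric_contraction_symm[OF T] L2_inner_add_left)
  have 2: "L2_inner M (T (\<lambda>x. f x - g x)) (\<lambda>x. f x - g x)
      = L2_inner M f (T f) - L2_inner M g (T f) - (L2_inner M f (T g) - L2_inner M g (T g))"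
    by (subst L2_inner_diff_right) (simp_all add: L symmetric_contraction_symm[OF T] L2_inner_diff_left)
  have 3: "L2_inner M (\<lambda>x. f x + g x) (\<lambda>x. f x + g x)
      = L2_inner M f f + L2_inner M g f + (L2_inner M f g + L2_inner M g g)"
    by (subst L2_inner_add_right) (simp_all add: L L2_inner_add_left)
  have 4: "L2_inner M (\<lambda>x. f x - g x) (\<lambda>x. f x - g x)
      = L2_inner M f f - L2_inner M g f - (L2_inner M f g - L2_inner M g g)"
    by (subst L2_inner_diff_right) (simp_all add: L L2_inner_diff_left)
  have "0 \<le> dirichlet_form M T (\<lambda>x. f x - g x)"
    by (rule dirichlet_form_nonneg[OF T fg'])
  then show ?thesis
    by (simp add: dirichlet_form_eq L 1 2 3 4
        L2_inner_commute[of M "T f" f] L2_inner_commute[of M "T g" g])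
qed

text \<open>The adjoint is selected by \<open>SOME\<close>. Applying \<open>A\<close> first and then
  \<open>B\<close> gives an operator with the defining property, so the selected one has it
  too.\<close>

lemma L2_inner_adjoint:
  assumes A: "symmetric_contraction M A" and B: "symmetric_contraction M B"
    and f: "f \<in> L2 M" and g: "g \<in> L2 M"
  defines "P \<equiv> \<lambda>f. A (B f)"
  shows "L2_adjoint M P g \<in> L2 M" and "L2_inner M (P f) g = L2_inner M f (L2_adjoint M P g)"
proof -
  let ?Q = "\<lambda>S. (\<forall>g \<in> L2 M. S g \<in> L2 M) \<and>
     (\<forall>f \<in> L2 M. \<forall>g \<in> L2 M. L2_inner M (P f) g = L2_inner M f (S g))"
  have "?Q (\<lambda>f. B (A f))"
    unfolding P_def
    by (auto simp: symmetric_contractionD[OF A] symmetric_contractionD[OF B])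
  then have "?Q (L2_adjoint M P)"
    unfolding L2_adjoint_def by (rule someI[where P="?Q"])
  then show "L2_adjoint M P g \<in> L2 M" and "L2_inner M (P f) g = L2_inner M f (L2_adjoint M P g)"
    using f g by auto
qed

text \<open>Moving the adjoint back across the inner product turns the energy of a product of the
  form \<open>P\<^sup>* P\<close> into the loss of squared norm under \<open>P\<close>.\<close>

lemma dirichlet_form_adjoint_comp:
  assumes A: "symmetric_contraction M A" and B: "symmetric_contraction M B" and f: "f \<in> L2 M"
  shows "dirichlet_form M (\<lambda>g. L2_adjoint M (\<lambda>f. A (B f)) (A (B g))) f
    = L2_inner M f f - L2_inner M (A (B f)) (A (B f))"
proof -
  have ABf: "A (B f) \<in> L2 M"
    by (intro symmetric_contraction_L2[OF A] symmetric_contraction_L2[OF B] f)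
  note adj = L2_inner_adjoint[OF A B f ABf]
  show ?thesis
    by (simp add: dirichlet_form_eq[where T="\<lambda>g. L2_adjoint M (\<lambda>f. A (B f)) (A (B g))", OF f adj(1)] adj(2)
        L2_inner_commute[of M f "L2_adjoint M (\<lambda>f. A (B f)) (A (B f))"])
qed

text \<open>Write \<open>G\<^sub>2 f = H f + d\<close> with \<open>d = G\<^sub>2 f - H f\<close>; since \<open>H G\<^sub>2 = G\<^sub>2\<close>, the squared norm
  of \<open>d\<close> is that of \<open>H f\<close> minus that of \<open>G\<^sub>2 f\<close>, hence at most the Dirichlet form of \<open>G\<^sub>2\<close>.\<close>

lemma gibbs_comparison:
  assumes G1: "symmetric_contraction M G\<^sub>1" and G2: "symmetric_contraction M G\<^sub>2"
    and H: "symmetric_contraction M H"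
    and idem1: "\<And>f. f \<in> L2 M \<Longrightarrow> G\<^sub>1 (G\<^sub>1 f) = G\<^sub>1 f" and idem2: "\<And>f. f \<in> L2 M \<Longrightarrow> G\<^sub>2 (G\<^sub>2 f) = G\<^sub>2 f"
    and HG: "\<And>f. f \<in> L2 M \<Longrightarrow> H (G\<^sub>2 f) = G\<^sub>2 f" and f: "f \<in> L2 M"
  shows "L2_inner M f f - L2_inner M (G\<^sub>1 (G\<^sub>2 f)) (G\<^sub>1 (G\<^sub>2 f))
    \<le> 2 * dirichlet_form M G\<^sub>1 (H f) + 3 * dirichlet_form M G\<^sub>2 f"
proof -
  define d where "d = (\<lambda>x. G\<^sub>2 f x - H f x)"
  note Gf = symmetric_contraction_L2[OF G2 f] and Hf = symmetric_contraction_L2[OF H f]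
  have d: "d \<in> L2 M" unfolding d_def by (rule L2_diff[OF Gf Hf])
  have GG: "L2_inner M (G\<^sub>2 f) (G\<^sub>2 f) = L2_inner M (G\<^sub>2 f) f"
    using symmetric_contraction_symm[OF G2 Gf f] by (simp add: idem2 f)
  have GH: "L2_inner M (G\<^sub>2 f) (H f) = L2_inner M (G\<^sub>2 f) f"
    using symmetric_contraction_symm[OF H Gf f] by (simp add: HG f)
  have "L2_inner M d d = L2_inner M (H f) (H f) - L2_inner M (G\<^sub>2 f) f"
    unfolding d_def
    by (subst L2_inner_diff_right)
       (simp_all add: Gf Hf L2_diff L2_inner_diff_left GG GH L2_inner_commute[of M "H f" "G\<^sub>2 f"])
  also have "\<dots> \<le> dirichlet_form M G\<^sub>2 f"
    using symmetric_contraction_le[OF H f] by (simp add: dirichlet_form_eq[where T=G\<^sub>2, OF f Gf])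
  finally have dd: "L2_inner M d d \<le> dirichlet_form M G\<^sub>2 f" .
  \<comment> \<open>For a self-adjoint idempotent the quadratic form is the squared norm of the
    image, so its Dirichlet form is the loss of squared norm.\<close>
  have G1_sq: "L2_inner M (G\<^sub>1 g) (G\<^sub>1 g) = L2_inner M (G\<^sub>1 g) g" if "g \<in> L2 M" for g
    using symmetric_contraction_symm[OF G1 symmetric_contraction_L2[OF G1 that] that] by (simp add: idem1 that)
  have "dirichlet_form M G\<^sub>1 d \<le> L2_inner M d d"
    using L2_inner_self_nonneg[of M "G\<^sub>1 d"]
    by (intro dirichlet_form_le_norm d symmetric_contraction_L2[OF G1]) (simp add: G1_sq[OF d])
  moreover have "dirichlet_form M G\<^sub>1 (\<lambda>x. H f x + d x) \<le> 2 * dirichlet_form M G\<^sub>1 (H f) + 2 * dirichlet_form M G\<^sub>1 d"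
    by (rule dirichlet_form_add_le[OF G1 Hf d])
  moreover have "(\<lambda>x. H f x + d x) = G\<^sub>2 f" by (simp add: d_def)
  ultimately have "dirichlet_form M G\<^sub>1 (G\<^sub>2 f) \<le> 2 * dirichlet_form M G\<^sub>1 (H f) + 2 * dirichlet_form M G\<^sub>2 f"
    using dd by simp
  \<comment> \<open>The loss telescopes along \<open>f\<close>, \<open>G\<^sub>2 f\<close>,
    \<open>G\<^sub>1 (G\<^sub>2 f)\<close>. The first loss adds one form of \<open>G\<^sub>2\<close>
    to the two already present, whence the constant 3.\<close>
  moreover have "L2_inner M f f - L2_inner M (G\<^sub>1 (G\<^sub>2 f)) (G\<^sub>1 (G\<^sub>2 f)) = dirichlet_form M G\<^sub>2 f + dirichlet_form M G\<^sub>1 (G\<^sub>2 f)"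
    by (simp add: dirichlet_form_eq f Gf symmetric_contraction_L2[OF G1] G1_sq GG)
  ultimately show ?thesis by simp
qed

section \<open>The functions \<open>K\<^sup>*\<close>\<close>

lemma Kstar_mono: "v \<le> w \<Longrightarrow> Kstar \<beta> v \<le> Kstar \<beta> w"
  unfolding Kstar_def by (intro SUP_subset_mono[OF order_refl]) (auto intro!: ereal_minus_mono ereal_mult_left_mono)

lemma Kstar_nonneg: "0 \<le> Kstar \<beta> v"
  unfolding Kstar_def by (rule SUP_upper2[of 0]) (auto simp: rate_K_def zero_ereal_def[symmetric] zero_ennreal.rep_eq)

lemma Kstar_leD:
  assumes "Kstar \<beta> (ereal v) \<le> ereal r" "0 \<le> u" "rate_K \<beta> u = ennreal k" "0 \<le> k"
  shows "u * v - k \<le> r"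
proof -
  have "ereal u * ereal v - enn2ereal (rate_K \<beta> u) \<le> ereal r"
    using assms(1,2) unfolding Kstar_def SUP_le_iff by auto
  then show ?thesis using assms(3,4) by (simp add: enn2ereal_ennreal)
qed

text \<open>Where \<open>rate_K\<close> is infinite, the term of the supremum is minus infinity, so
  only finite values have to be checked.\<close>

lemma Kstar_leI:
  assumes "\<And>u k. 0 \<le> u \<Longrightarrow> 0 \<le> k \<Longrightarrow> rate_K \<beta> u = ennreal k \<Longrightarrow> u * v - k \<le> r"
  shows "Kstar \<beta> (ereal v) \<le> ereal r"
  unfolding Kstar_def
proof (rule SUP_least)
  fix u :: real assume u: "u \<in> {0..}"
  show "ereal u * ereal v - enn2ereal (rate_K \<beta> u) \<le> ereal r"
  proof (cases "rate_K \<beta> u" rule: ennreal_cases)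
    case (real k)
    then show ?thesis using assms[of u k] u by (simp add: enn2ereal_ennreal)
  qed simp
qed

text \<open>Put \<open>s = 1 / u\<close> and multiply the inequality by \<open>u\<close>: this
  passes from a weak Poincare inequality to its conjugate form. The term at \<open>u = 0\<close> is
  covered by \<open>0 \<le> r\<close>.\<close>

lemma Kstar_leI_rate:
  assumes "0 \<le> r" "\<And>s b. 0 < s \<Longrightarrow> 0 \<le> b \<Longrightarrow> \<beta> s = ennreal b \<Longrightarrow> v \<le> s * r + b"
  shows "Kstar \<beta> (ereal v) \<le> ereal r"
proof (rule Kstar_leI)
  fix u k :: real assume u: "0 \<le> u" and k: "0 \<le> k" "rate_K \<beta> u = ennreal k"
  show "u * v - k \<le> r"
  proof (cases "u = 0")
    case False
    with u have u: "0 < u" by simp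
    have eq: "ennreal u * \<beta> (1 / u) = ennreal k" using k(2) False by (simp add: rate_K_def)
    show ?thesis
    proof (cases "\<beta> (1 / u)" rule: ennreal_cases)
      case (real b)
      then have "u * b = k" using eq u k(1) by (simp flip: ennreal_mult)
      moreover have "v \<le> 1 / u * r + b" using assms(2)[of "1 / u" b] u real by simp
      then have "u * v \<le> u * (1 / u * r + b)" using u by (intro mult_left_mono) auto
      ultimately show ?thesis using u by (simp add: distrib_left)
    next
      case top
      then show ?thesis using eq u by (simp add: ennreal_mult_top)
    qed
  qed (use assms(1) k in simp)
qed

text \<open>Convexity: \<open>Kstar\<close> is a supremum of affine functions of
  \<open>v\<close>.\<close>

lemma Kstar_midpoint:
  assumes "Kstar \<beta> (ereal x) \<le> ereal a" "Kstar \<beta> (ereal y) \<le> ereal b"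
  shows "Kstar \<beta> (ereal ((x + y) / 2)) \<le> ereal ((a + b) / 2)"
proof (rule Kstar_leI)
  fix u k :: real assume u: "0 \<le> u" and k: "0 \<le> k" "rate_K \<beta> u = ennreal k"
  have "u * x - k \<le> a" "u * y - k \<le> b"
    using Kstar_leD[OF assms(1) u k(2,1)] Kstar_leD[OF assms(2) u k(2,1)] by auto
  then show "u * ((x + y) / 2) - k \<le> (a + b) / 2" by (simp add: field_simps)
qed

text \<open>The affine functions in the supremum have intercepts \<open>- k \<le> 0\<close>, and
  such a function at \<open>x / 4\<close> is at most a quarter of its value at
  \<open>x\<close>.\<close>

lemma Kstar_quarter:
  assumes "Kstar \<beta> (ereal x) \<le> ereal a"
  shows "Kstar \<beta> (ereal (x / 4)) \<le> ereal (a / 4)"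
proof (rule Kstar_leI)
  fix u k :: real assume u: "0 \<le> u" and k: "0 \<le> k" "rate_K \<beta> u = ennreal k"
  have "u * x - k \<le> a" using Kstar_leD[OF assms u k(2,1)] .
  then show "u * (x / 4) - k \<le> a / 4" using k(1) by (simp add: field_simps)
qed

text \<open>The numerical core of the argument: \<open>a\<close>, \<open>b\<close>,
  \<open>c\<close>, \<open>e\<close> stand for the quantities \<open>A\<close>, \<open>B\<close>,
  \<open>C\<close>, \<open>E\<close> divided by the squared oscillation.\<close>

lemma Kstar_chain:
  assumes K0: "Kstar \<beta>\<^sub>0 (ereal v) \<le> ereal (2 * c + 3 * e)"
    and K2: "Kstar \<beta>\<^sub>2 (ereal e) \<le> ereal a" and K1: "Kstar \<beta>\<^sub>1 (ereal c) \<le> ereal b"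
    and n: "normalised \<beta>\<^sub>1" "normalised \<beta>\<^sub>2"
    and a: "0 \<le> a" "a \<le> 1/4" and c: "0 \<le> c" "c \<le> 1/4" and e: "0 \<le> e"
  shows "2 * Kstar \<beta>\<^sub>1 (Kstar \<beta>\<^sub>2 (1 / 2 * Kstar \<beta>\<^sub>0 (ereal v / 4))) \<le> ereal (a + b)"
proof -
  have "Kstar \<beta>\<^sub>0 (ereal (v / 4)) \<le> ereal ((2 * c + 3 * e) / 4)"
    using K0 by (rule Kstar_quarter)
  \<comment> \<open>The factor 1/4 in the argument absorbs the constants 2 and 3.\<close>
  then have k: "Kstar \<beta>\<^sub>0 (ereal (v / 4)) \<le> ereal (c + e)"
    by (rule order_trans) (use c e in simp)
  \<comment> \<open>A nonnegative extended real below a real number is real, so the outer functions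
    can be evaluated at real arguments.\<close>
  then obtain k0 where k0: "Kstar \<beta>\<^sub>0 (ereal (v / 4)) = ereal k0"
    using Kstar_nonneg[of \<beta>\<^sub>0 "ereal (v / 4)"] by (cases "Kstar \<beta>\<^sub>0 (ereal (v / 4))") auto
  have half: "1 / 2 * ereal r = ereal (r / 2)" for r
    by (simp add: one_ereal_def)
  have "Kstar \<beta>\<^sub>2 (ereal (k0 / 2)) \<le> Kstar \<beta>\<^sub>2 (ereal ((e + c) / 2))"
    using k k0 by (intro Kstar_mono) simp
  \<comment> \<open>Midpoint of \<open>e\<close>, where the bound \<open>a\<close> is given, and
    \<open>c\<close>, where the normalisation gives the bound \<open>c\<close>.\<close>
  also have "\<dots> \<le> ereal ((a + c) / 2)"
    using n(2) c by (intro Kstar_midpoint K2) (simp add: normalised_def)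
  finally have "Kstar \<beta>\<^sub>1 (Kstar \<beta>\<^sub>2 (ereal (k0 / 2))) \<le> Kstar \<beta>\<^sub>1 (ereal ((a + c) / 2))"
    by (rule Kstar_mono)
  \<comment> \<open>The roles are now reversed: the normalisation bounds the value at
    \<open>a\<close> by \<open>a\<close>, and the value at \<open>c\<close> is at most
    \<open>b\<close>.\<close>
  also have "\<dots> \<le> ereal ((a + b) / 2)"
    using n(1) a by (intro Kstar_midpoint K1) (simp add: normalised_def)
  finally have "2 * Kstar \<beta>\<^sub>1 (Kstar \<beta>\<^sub>2 (ereal (k0 / 2))) \<le> 2 * ereal ((a + b) / 2)"
    by (intro ereal_mult_left_mono) auto
  also have "2 * ereal ((a + b) / 2) = ereal (a + b)"
    by (simp add: field_simps)
  finally show ?thesis using k0 by (simp add: half)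
qed

section \<open>Oscillation and variance\<close>

lemma osc_norm_eq: "osc_norm M f = esssup M (\<lambda>x. ereal (f x)) + esssup M (\<lambda>x. ereal (- f x))"
  by (simp add: osc_norm_def minus_ereal_def)

lemma osc_norm_leI:
  assumes f: "f \<in> borel_measurable M" and "AE x in M. f x \<le> a" "AE x in M. b \<le> f x"
  shows "osc_norm M f \<le> ereal (a - b)"
proof -
  have "esssup M (\<lambda>x. ereal (f x)) \<le> ereal a"
    using assms by (intro esssup_I) auto
  moreover have "esssup M (\<lambda>x. ereal (- f x)) \<le> ereal (- b)"
    using assms by (intro esssup_I) auto
  ultimately have "osc_norm M f \<le> ereal a + ereal (- b)"
    unfolding osc_norm_eq by (rule add_mono)
  then show ?thesis by simp
qed

text \<open>At almost every point \<open>f x\<close> and \<open>- f x\<close> lie below their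
  essential suprema and sum to 0; positive total mass then turns the almost sure statement into a
  plain one.\<close>

lemma (in prob_space) osc_norm_nonneg: "0 \<le> osc_norm M f"
proof -
  have "AE x in M. 0 \<le> osc_norm M f"
    using esssup_AE[of "\<lambda>x. ereal (f x)" M] esssup_AE[of "\<lambda>x. ereal (- f x)" M]
  proof eventually_elim
    case (elim x)
    have "0 = ereal (f x) + ereal (- f x)" by simp
    also have "\<dots> \<le> osc_norm M f" unfolding osc_norm_eq using elim by (rule add_mono)
    finally show ?case .
  qed
  then show ?thesis by simp
qed

lemma (in prob_space) osc_norm_bounds:
  assumes "osc_norm M f < \<infinity>"
  obtains a b where "AE x in M. f x \<le> a" "AE x in M. b \<le> f x" "osc_norm M f = ereal (a - b)"
proof -
  \<comment> \<open>With this, finiteness of the sum of the two essential suprema forces each of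
    them to be finite.\<close>
  have not_bot: "esssup M (\<lambda>x. ereal (g x)) \<noteq> -\<infinity>" for g
  proof
    assume *: "esssup M (\<lambda>x. ereal (g x)) = -\<infinity>"
    have "AE x in M. False"
      using esssup_AE[of "\<lambda>x. ereal (g x)" M] unfolding * by eventually_elim simp
    then show False by simp
  qed
  obtain a where a: "esssup M (\<lambda>x. ereal (f x)) = ereal a"
    using assms not_bot[of f] not_bot[of "\<lambda>x. - f x"] unfolding osc_norm_eq
    by (cases "esssup M (\<lambda>x. ereal (f x))"; cases "esssup M (\<lambda>x. ereal (- f x))") auto
  obtain b where b: "esssup M (\<lambda>x. ereal (- f x)) = ereal (- b)"
    using assms not_bot[of f] not_bot[of "\<lambda>x. - f x"] unfolding osc_norm_eq
    by (cases "esssup M (\<lambda>x. ereal (- f x))"; cases "esssup M (\<lambda>x. ereal (f x))")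
       (auto, metis add.inverse_inverse uminus_ereal.simps(1))
  have 1: "AE x in M. f x \<le> a"
    using esssup_AE[of "\<lambda>x. ereal (f x)" M] unfolding a by simp
  have 2: "AE x in M. b \<le> f x"
    using esssup_AE[of "\<lambda>x. ereal (- f x)" M] unfolding b by simp
  show thesis using 1 2 by (rule that) (simp add: osc_norm_eq a b)
qed

text \<open>Integrate \<open>(a - f) (f - b) \<ge> 0\<close>.\<close>

lemma mean_zero_norm_le:
  assumes M: "prob_space M" and f: "f \<in> L2_mean_zero M"
    and ab: "AE x in M. f x \<le> a" "AE x in M. b \<le> f x"
  shows "L2_inner M f f \<le> (a - b)\<^sup>2 / 4"
proof -
  interpret prob_space M by (rule M)
  have f2: "f \<in> L2 M" and f0: "expectation f = 0" using f by (auto simp: L2_mean_zero_def)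
  have i: "integrable M f" using M f2 by (rule L2_integrable)
  have ff: "integrable M (\<lambda>x. f x * f x)" using f2 f2 by (rule L2_mult_integrable)
  have "0 \<le> expectation (\<lambda>x. (a - f x) * (f x - b))"
  proof (rule integral_nonneg_AE)
    show "AE x in M. 0 \<le> (a - f x) * (f x - b)"
      using ab by eventually_elim simp
  qed
  also have "\<dots> = expectation (\<lambda>x. (a + b) * f x - a * b - f x * f x)"
    by (simp add: algebra_simps)
  also have "\<dots> = - (a * b) - L2_inner M f f"
    using i ff f0 by (simp add: L2_inner_def prob_space)
  finally have "L2_inner M f f \<le> - (a * b)" by simp
  also have "\<dots> \<le> (a - b)\<^sup>2 / 4"
    using zero_le_power2[of "a + b"] by (simp add: power2_eq_square algebra_simps)
  finally show ?thesis .
qed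

text \<open>The variance is the Dirichlet form of averaging against \<open>M\<close>. Taken with
  \<open>M\<close> a conditional law, it integrates over the fibres to the Dirichlet form of a Gibbs
  projection.\<close>

lemma variance_eq_dirichlet_form:
  assumes M: "prob_space M" and h: "h \<in> L2 M"
  shows "prob_space.variance M h = dirichlet_form M (\<lambda>h x. \<integral>y. h y \<partial>M) h"
proof -
  interpret prob_space M by (rule M)
  have i: "integrable M h" using M h by (rule L2_integrable)
  have i2: "integrable M (\<lambda>x. (h x)\<^sup>2)" using h by (simp add: L2_def)
  have "variance h = expectation (\<lambda>x. (h x)\<^sup>2) - (expectation h)\<^sup>2"
    using i i2 by (rule variance_eq)
  also have "\<dots> = expectation (\<lambda>x. (h x)\<^sup>2 - expectation h * h x)"
    using i i2 by (simp add: power2_eq_square)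
  also have "\<dots> = dirichlet_form M (\<lambda>h x. \<integral>y. h y \<partial>M) h"
    by (simp add: dirichlet_form_def L2_inner_def algebra_simps power2_eq_square)
  finally show ?thesis .
qed

section \<open>Conditional kernels\<close>

text \<open>\<open>p\<close> is the conditioning coordinate, \<open>q\<close> the other one, and \<open>e i j\<close> the point with coordinates
  \<open>i\<close> and \<open>j\<close>; this treats the two coordinate directions of a product uniformly.\<close>

locale disintegration = prob_space \<pi> for \<pi> :: "'z::topological_space measure" +
  fixes p :: "'z \<Rightarrow> 'i::topological_space" and q :: "'z \<Rightarrow> 'j::topological_space"
    and e :: "'i \<Rightarrow> 'j \<Rightarrow> 'z" and \<kappa> :: "'i \<Rightarrow> 'j measure"
  assumes sets_pi[measurable_cong]: "sets \<pi> = sets borel"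
    and p[measurable]: "p \<in> borel \<rightarrow>\<^sub>M borel" and q[measurable]: "q \<in> borel \<rightarrow>\<^sub>M borel"
    and e: "(\<lambda>(i, j). e i j) \<in> borel \<Otimes>\<^sub>M borel \<rightarrow>\<^sub>M borel"
    and p_e[simp]: "p (e i j) = i" and q_e[simp]: "q (e i j) = j" and e_pq[simp]: "e (p z) (q z) = z"
    and kappa: "\<kappa> \<in> borel \<rightarrow>\<^sub>M prob_algebra borel"
    and disint: "A \<in> sets borel \<Longrightarrow> B \<in> sets borel \<Longrightarrow>
      emeasure \<pi> (p -` A \<inter> q -` B) = (\<integral>\<^sup>+i\<in>A. emeasure (\<kappa> i) B \<partial>distr \<pi> borel p)"
begin

abbreviation "N \<equiv> distr \<pi> borel p"

lemma space_pi: "space \<pi> = UNIV"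
  using sets_eq_imp_space_eq[OF sets_pi] by simp

lemma measurable_pi: "\<pi> \<rightarrow>\<^sub>M L = borel \<rightarrow>\<^sub>M L"
  by (rule measurable_cong_sets[OF sets_pi refl])

lemma measurable_e[measurable]: "e i \<in> borel \<rightarrow>\<^sub>M borel"
  using measurable_compose[OF measurable_Pair1' e, of i] by simp

lemma measurable_e_pair[measurable]: "(\<lambda>w. e (fst w) (snd w)) \<in> borel \<Otimes>\<^sub>M borel \<rightarrow>\<^sub>M borel"
  using e by (simp add: case_prod_unfold)

lemma prob_kappa: "prob_space (\<kappa> i)" and sets_kappa: "sets (\<kappa> i) = sets borel"
  using measurable_space[OF kappa, of i] by (auto simp: space_prob_algebra)

lemma prob_N: "prob_space N"
  by (rule prob_space_distr) (simp add: measurable_pi p)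

lemma kappa_N: "\<kappa> \<in> N \<rightarrow>\<^sub>M prob_algebra borel"
  using kappa by simp

lemma measurable_pq: "(\<lambda>z. (p z, q z)) \<in> \<pi> \<rightarrow>\<^sub>M borel \<Otimes>\<^sub>M borel"
  unfolding measurable_pi by simp

section \<open>Integration over the fibres\<close>

lemma distr_pq: "distr \<pi> (borel \<Otimes>\<^sub>M borel) (\<lambda>z. (p z, q z)) = semidirect N \<kappa> borel"
proof (rule semidirect_eqI[OF prob_N kappa_N])
  show "finite_measure (distr \<pi> (borel \<Otimes>\<^sub>M borel) (\<lambda>z. (p z, q z)))"
    by (intro prob_space.finite_measure prob_space_distr measurable_pq)
  show "sets (distr \<pi> (borel \<Otimes>\<^sub>M borel) (\<lambda>z. (p z, q z))) = sets (N \<Otimes>\<^sub>M borel)"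
    unfolding sets_distr by (rule sets_pair_measure_cong) simp_all
  fix A :: "'i set" and B :: "'j set" assume "A \<in> sets N" "B \<in> sets borel"
  then have A: "A \<in> sets borel" and B: "B \<in> sets borel" by auto
  have "emeasure (distr \<pi> (borel \<Otimes>\<^sub>M borel) (\<lambda>z. (p z, q z))) (A \<times> B)
      = emeasure \<pi> ((\<lambda>z. (p z, q z)) -` (A \<times> B) \<inter> space \<pi>)"
    using A B by (intro emeasure_distr measurable_pq) simp
  also have "(\<lambda>z. (p z, q z)) -` (A \<times> B) \<inter> space \<pi> = p -` A \<inter> q -` B"
    by (auto simp: space_pi)
  finally show "emeasure (distr \<pi> (borel \<Otimes>\<^sub>M borel) (\<lambda>z. (p z, q z))) (A \<times> B)
      = (\<integral>\<^sup>+i\<in>A. emeasure (\<kappa> i) B \<partial>N)"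
    by (simp add: disint[OF A B])
qed

lemma nn_integral_disintegration:
  assumes f: "f \<in> borel_measurable borel"
  shows "(\<integral>\<^sup>+z. f z \<partial>\<pi>) = (\<integral>\<^sup>+i. (\<integral>\<^sup>+j. f (e i j) \<partial>\<kappa> i) \<partial>N)"
proof -
  have m: "(\<lambda>w. f (e (fst w) (snd w))) \<in> borel_measurable (borel \<Otimes>\<^sub>M borel)"
    by (rule measurable_compose[OF measurable_e_pair f])
  have m': "(\<lambda>w. f (e (fst w) (snd w))) \<in> borel_measurable (N \<Otimes>\<^sub>M borel)"
    using m by (subst measurable_cong_sets[OF sets_pair_measure_cong[OF sets_distr refl] refl])
  have "(\<integral>\<^sup>+w. f (e (fst w) (snd w)) \<partial>distr \<pi> (borel \<Otimes>\<^sub>M borel) (\<lambda>z. (p z, q z))) = (\<integral>\<^sup>+z. f z \<partial>\<pi>)"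
    using nn_integral_distr[OF measurable_pq, of "\<lambda>w. f (e (fst w) (snd w))"] m by simp
  then show ?thesis
    unfolding distr_pq using nn_integral_semidirect[OF prob_N kappa_N m'] by simp
qed

lemma integral_disintegration:
  fixes f :: "'z \<Rightarrow> real"
  assumes f: "integrable \<pi> f"
  shows AE_integrable_disintegration: "AE i in N. integrable (\<kappa> i) (\<lambda>j. f (e i j))"
    and integrable_integral_disintegration: "integrable N (\<lambda>i. \<integral>j. f (e i j) \<partial>\<kappa> i)"
    and integral_integral_disintegration: "(\<integral>i. (\<integral>j. f (e i j) \<partial>\<kappa> i) \<partial>N) = (\<integral>z. f z \<partial>\<pi>)"
proof -
  have m: "(\<lambda>w. f (e (fst w) (snd w))) \<in> borel_measurable (borel \<Otimes>\<^sub>M borel)"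
    using borel_measurable_integrable[OF f] unfolding measurable_pi
    by (rule measurable_compose[OF measurable_e_pair])
  have "integrable (semidirect N \<kappa> borel) (\<lambda>w. f (e (fst w) (snd w)))"
    unfolding distr_pq[symmetric] using integrable_distr_eq[OF measurable_pq m] f by simp
  then have "integrable (semidirect N \<kappa> borel) (\<lambda>(i, j). f (e i j))"
    by (simp add: case_prod_unfold)
  note * = integral_semidirect[OF prob_N kappa_N this]
  have "(\<integral>w. f (e (fst w) (snd w)) \<partial>semidirect N \<kappa> borel) = (\<integral>z. f z \<partial>\<pi>)"
    unfolding distr_pq[symmetric] using integral_distr[OF measurable_pq m] by simp
  with * show "AE i in N. integrable (\<kappa> i) (\<lambda>j. f (e i j))"
    and "integrable N (\<lambda>i. \<integral>j. f (e i j) \<partial>\<kappa> i)"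
    and "(\<integral>i. (\<integral>j. f (e i j) \<partial>\<kappa> i) \<partial>N) = (\<integral>z. f z \<partial>\<pi>)"
    by auto
qed

lemma AE_disintegration:
  assumes "AE z in \<pi>. Q z"
  shows "AE i in N. AE j in \<kappa> i. Q (e i j)"
proof -
  obtain S where S: "{z \<in> space \<pi>. \<not> Q z} \<subseteq> S" "S \<in> null_sets \<pi>"
    using assms by (auto simp: eventually_ae_filter)
  have Sb: "S \<in> sets borel" using S(2) sets_pi by auto
  have SQ: "Q z" if "z \<notin> S" for z using that S(1) by (auto simp: space_pi)
  have meas: "{w \<in> space (borel \<Otimes>\<^sub>M borel). e (fst w) (snd w) \<notin> S} \<in> sets (borel \<Otimes>\<^sub>M borel)"
    using Sb by measurable
  have "AE w in distr \<pi> (borel \<Otimes>\<^sub>M borel) (\<lambda>z. (p z, q z)). e (fst w) (snd w) \<notin> S"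
    using AE_not_in[OF S(2)] by (simp add: AE_distr_iff[OF measurable_pq meas])
  then have "AE w in semidirect N \<kappa> borel. e (fst w) (snd w) \<notin> S"
    unfolding distr_pq .
  from AE_semidirect[OF prob_N kappa_N this]
  show ?thesis
    by (rule eventually_mono) (auto elim!: eventually_mono intro: SQ)
qed

lemma AE_L2_fibre:
  assumes h: "h \<in> L2 \<pi>"
  shows "AE i in N. (\<lambda>j. h (e i j)) \<in> L2 (\<kappa> i)"
proof -
  have hb: "h \<in> borel_measurable borel" using h by (simp add: L2_def measurable_pi)
  have "(\<lambda>j. h (e i j)) \<in> borel_measurable (\<kappa> i)" for i
    using measurable_compose[OF measurable_e hb, of i] by (simp add: measurable_cong_sets[OF sets_kappa refl])
  moreover have "AE i in N. integrable (\<kappa> i) (\<lambda>j. (h (e i j))\<^sup>2)"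
    using h by (intro AE_integrable_disintegration) (simp add: L2_def)
  ultimately show ?thesis by (simp add: L2_def)
qed

section \<open>Updates of the free coordinate\<close>

definition fibre_op :: "('i \<Rightarrow> 'j \<Rightarrow> 'j measure) \<Rightarrow> ('z \<Rightarrow> real) \<Rightarrow> 'z \<Rightarrow> real" where
  "fibre_op H f z = (\<integral>j. f (e (p z) j) \<partial>H (p z) (q z))"

text \<open>The same update viewed as a kernel on the whole space that freezes \<open>p z\<close>,
  so that the results on reversible kernels apply to it.\<close>

definition fibre_kernel :: "('i \<Rightarrow> 'j \<Rightarrow> 'j measure) \<Rightarrow> 'z \<Rightarrow> 'z measure" where
  "fibre_kernel H z = distr (H (p z) (q z)) borel (e (p z))"

definition reversible_fibres :: "('i \<Rightarrow> 'j \<Rightarrow> 'j measure) \<Rightarrow> bool" where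
  "reversible_fibres H \<longleftrightarrow> (\<lambda>z. H (p z) (q z)) \<in> borel \<rightarrow>\<^sub>M prob_algebra borel \<and>
     (\<forall>i. reversible (\<kappa> i) (H i))"

abbreviation "gibbs_op \<equiv> fibre_op (\<lambda>i j. \<kappa> i)"

text \<open>For an independent draw both sides of detailed balance are the product of the masses of
  the two sets.\<close>

lemma reversible_fibres_kappa: "reversible_fibres (\<lambda>i j. \<kappa> i)"
  unfolding reversible_fibres_def
proof (intro conjI allI)
  show "(\<lambda>z. \<kappa> (p z)) \<in> borel \<rightarrow>\<^sub>M prob_algebra borel"
    by (rule measurable_compose[OF p kappa])
  show "reversible (\<kappa> i) (\<lambda>j. \<kappa> i)" for i
    by (simp add: reversible_def nn_integral_cmult_indicator) (simp add: mult.commute)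
qed

context
  fixes H assumes H: "reversible_fibres H"
begin

lemma H_meas: "(\<lambda>z. H (p z) (q z)) \<in> borel \<rightarrow>\<^sub>M prob_algebra borel"
  and H_rev: "reversible (\<kappa> i) (H i)"
  using H by (auto simp: reversible_fibres_def)

lemma prob_H: "prob_space (H i j)" and sets_H: "sets (H i j) = sets borel"
  using measurable_space[OF H_meas, of "e i j"] by (auto simp: space_prob_algebra)

lemma measurable_fibre_kernel: "fibre_kernel H \<in> borel \<rightarrow>\<^sub>M prob_algebra borel"
  unfolding fibre_kernel_def
  by (rule measurable_distr_prob_space2[OF H_meas])
     (use measurable_compose[OF _ measurable_e_pair, of "\<lambda>w. (p (fst w), snd w)" "borel \<Otimes>\<^sub>M borel"]
      in \<open>simp add: case_prod_unfold\<close>)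

lemma emeasure_fibre_kernel:
  assumes B: "B \<in> sets borel"
  shows "emeasure (fibre_kernel H (e i j)) B = emeasure (H i j) (e i -` B)"
proof -
  have "e i \<in> H i j \<rightarrow>\<^sub>M borel"
    by (simp add: measurable_cong_sets[OF sets_H refl])
  moreover have "space (H i j) = UNIV" using sets_eq_imp_space_eq[OF sets_H] by simp
  ultimately show ?thesis
    unfolding fibre_kernel_def using B by (simp add: emeasure_distr)
qed

text \<open>Disintegrating both sides reduces detailed balance on the whole space to detailed
  balance on each fibre, applied to the sections of the two sets.\<close>

lemma reversible_fibre_kernel: "reversible \<pi> (fibre_kernel H)"
proof -
  have *: "(\<integral>\<^sup>+z\<in>A. emeasure (fibre_kernel H z) B \<partial>\<pi>)
      = (\<integral>\<^sup>+i. (\<integral>\<^sup>+j\<in>e i -` A. emeasure (H i j) (e i -` B) \<partial>\<kappa> i) \<partial>N)"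
    if A: "A \<in> sets borel" and B: "B \<in> sets borel" for A B
  proof -
    have "(\<lambda>z. emeasure (fibre_kernel H z) B) \<in> borel_measurable borel"
      by (rule measurable_compose[OF measurable_prob_algebraD[OF measurable_fibre_kernel]
            measurable_emeasure_subprob_algebra[OF B]])
    then have "(\<integral>\<^sup>+z\<in>A. emeasure (fibre_kernel H z) B \<partial>\<pi>)
        = (\<integral>\<^sup>+i. (\<integral>\<^sup>+j. emeasure (fibre_kernel H (e i j)) B * indicator A (e i j) \<partial>\<kappa> i) \<partial>N)"
      using A by (intro nn_integral_disintegration borel_measurable_times_ennreal borel_measurable_indicator)
    also have "\<dots> = (\<integral>\<^sup>+i. (\<integral>\<^sup>+j\<in>e i -` A. emeasure (H i j) (e i -` B) \<partial>\<kappa> i) \<partial>N)"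
      by (intro nn_integral_cong) (simp add: emeasure_fibre_kernel[OF B] indicator_def)
    finally show ?thesis .
  qed
  show ?thesis
    unfolding reversible_def
  proof (intro ballI)
    fix A B assume "A \<in> sets \<pi>" "B \<in> sets \<pi>"
    then have AB: "A \<in> sets borel" "B \<in> sets borel" by (auto simp: sets_pi)
    have s: "e i -` C \<in> sets (\<kappa> i)" if "C \<in> sets borel" for i C
      using measurable_sets[OF measurable_e that, of i] by (simp add: sets_kappa)
    show "(\<integral>\<^sup>+z\<in>A. emeasure (fibre_kernel H z) B \<partial>\<pi>) = (\<integral>\<^sup>+z\<in>B. emeasure (fibre_kernel H z) A \<partial>\<pi>)"
      unfolding *[OF AB] *[OF AB(2,1)]
      by (rule nn_integral_cong) (use H_rev s AB in \<open>auto simp: reversible_def\<close>)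
  qed
qed

lemma reversible_kernel_fibre: "reversible_kernel \<pi> (fibre_kernel H)"
proof
  have "prob_algebra \<pi> = prob_algebra borel" 
    unfolding prob_algebra_def by (simp add: subprob_algebra_cong[OF sets_pi])
  then show "fibre_kernel H \<in> \<pi> \<rightarrow>\<^sub>M prob_algebra \<pi>"
    using measurable_fibre_kernel by (simp add: measurable_pi)
qed (rule reversible_fibre_kernel)

lemma fibre_op_eq_kernel_op:
  assumes f: "f \<in> L2 \<pi>"
  shows "fibre_op H f = kernel_op (fibre_kernel H) f"
proof
  fix z
  have "f \<in> borel_measurable borel" using f by (simp add: L2_def measurable_pi)
  then show "fibre_op H f z = kernel_op (fibre_kernel H) f z"
    unfolding fibre_op_def kernel_op_def fibre_kernel_def
    by (subst integral_distr) (simp_all add: measurable_cong_sets[OF sets_H refl])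
qed

lemma symmetric_contraction_fibre_op: "symmetric_contraction \<pi> (fibre_op H)"
  unfolding symmetric_contraction_def
  using symmetric_contractionD[OF reversible_kernel.symmetric_contraction_kernel_op[OF reversible_kernel_fibre]]
  by (simp add: fibre_op_eq_kernel_op)

lemma fibre_op_AE_le: "f \<in> L2 \<pi> \<Longrightarrow> AE z in \<pi>. f z \<le> c \<Longrightarrow> AE z in \<pi>. fibre_op H f z \<le> c"
  using reversible_kernel.kernel_op_AE_le[OF reversible_kernel_fibre]
  by (simp add: fibre_op_eq_kernel_op)

lemma fibre_op_AE_ge:
  assumes f: "f \<in> L2 \<pi>" and c: "AE z in \<pi>. c \<le> f z"
  shows "AE z in \<pi>. c \<le> fibre_op H f z"
proof -
  have "(\<lambda>z. - f z) \<in> L2 \<pi>" using f by (simp add: L2_def)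
  from fibre_op_AE_le[OF this, of "- c"] c show ?thesis by (simp add: fibre_op_def)
qed

text \<open>The image of \<open>gibbs_op\<close> is constant along each fibre, and an update by a
  probability kernel fixes such functions. With \<open>\<kappa>\<close> as the update this is
  idempotence.\<close>

lemma fibre_op_gibbs_op: "fibre_op H (gibbs_op f) = gibbs_op f"
  using prob_space.prob_space[OF prob_H] by (simp add: fun_eq_iff fibre_op_def)

lemma integral_inner_fibre_op:
  assumes h: "h \<in> L2 \<pi>"
  shows "(\<integral>i. L2_inner (\<kappa> i) (kernel_op (H i) (\<lambda>j. h (e i j))) (\<lambda>j. h (e i j)) \<partial>N) = L2_inner \<pi> (fibre_op H h) h"
  using integral_integral_disintegration[OF L2_mult_integrable[OF symmetric_contraction_L2[OF symmetric_contraction_fibre_op h] h]]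
  by (simp add: L2_inner_def fibre_op_def kernel_op_def)

lemma fibre_op_positive:
  assumes pos: "\<And>i. positive_kernel (\<kappa> i) (H i)" and h: "h \<in> L2 \<pi>"
  shows "0 \<le> L2_inner \<pi> (fibre_op H h) h"
  unfolding integral_inner_fibre_op[OF h, symmetric]
proof (rule integral_nonneg_AE)
  show "AE i in N. 0 \<le> L2_inner (\<kappa> i) (kernel_op (H i) (\<lambda>j. h (e i j))) (\<lambda>j. h (e i j))"
    using AE_L2_fibre[OF h]
    by eventually_elim (use pos in \<open>auto simp: positive_kernel_def\<close>)
qed

lemma
  assumes h: "h \<in> L2 \<pi>"
  shows integrable_dirichlet_form_fibre:
      "integrable N (\<lambda>i. dirichlet_form (\<kappa> i) (kernel_op (H i)) (\<lambda>j. h (e i j)))"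
    and integral_dirichlet_form_fibre:
      "(\<integral>i. dirichlet_form (\<kappa> i) (kernel_op (H i)) (\<lambda>j. h (e i j)) \<partial>N) = dirichlet_form \<pi> (fibre_op H) h"
proof -
  have "integrable \<pi> (\<lambda>z. (h z - fibre_op H h z) * h z)"
    by (intro L2_mult_integrable L2_diff h symmetric_contraction_L2[OF symmetric_contraction_fibre_op])
  from integrable_integral_disintegration[OF this] integral_integral_disintegration[OF this]
  show "integrable N (\<lambda>i. dirichlet_form (\<kappa> i) (kernel_op (H i)) (\<lambda>j. h (e i j)))"
    and "(\<integral>i. dirichlet_form (\<kappa> i) (kernel_op (H i)) (\<lambda>j. h (e i j)) \<partial>N) = dirichlet_form \<pi> (fibre_op H) h"
    by (simp_all add: dirichlet_form_def L2_inner_def fibre_op_def kernel_op_def)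
qed

end

lemmas symmetric_contraction_gibbs_op = symmetric_contraction_fibre_op[OF reversible_fibres_kappa]

text \<open>The conditional inequality is integrated over the conditioning coordinate. On almost
  every fibre \<open>h\<close> keeps the bounds \<open>a\<close> and \<open>b\<close>, so one
  oscillation bound serves all of them; the finite average \<open>r\<close> makes the rate
  integrable.\<close>

lemma dirichlet_form_gibbs_op_le:
  fixes \<beta> :: "real \<Rightarrow> 'i \<Rightarrow> real"
  assumes H: "reversible_fibres H" and s: "s > 0"
    and wpi: "\<And>i h. h \<in> L2 (\<kappa> i) \<Longrightarrow>
           ereal (prob_space.variance (\<kappa> i) h)
           \<le> ereal (s * dirichlet_form (\<kappa> i) (kernel_op (H i)) h) + ereal (\<beta> s i) * (osc_norm (\<kappa> i) h)\<^sup>2"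
    and beta: "\<beta> s \<in> borel_measurable borel" "\<And>i. 0 \<le> \<beta> s i"
    and avg: "averaged_rate N \<beta> s = ennreal r" "0 \<le> r"
    and h: "h \<in> L2 \<pi>" and ab: "AE z in \<pi>. h z \<le> a" "AE z in \<pi>. b \<le> h z"
  shows "dirichlet_form \<pi> gibbs_op h \<le> s * dirichlet_form \<pi> (fibre_op H) h + r * (a - b)\<^sup>2"
proof -
  have bi: "integrable N (\<beta> s)"
    using beta avg by (intro integrableI_nonneg) (auto simp: averaged_rate_def)
  have br: "(\<integral>i. \<beta> s i \<partial>N) = r"
    using beta avg by (subst integral_eq_nn_integral) (auto simp: averaged_rate_def)
  have "AE i in N. dirichlet_form (\<kappa> i) (kernel_op (\<lambda>j. \<kappa> i)) (\<lambda>j. h (e i j))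
      \<le> s * dirichlet_form (\<kappa> i) (kernel_op (H i)) (\<lambda>j. h (e i j)) + \<beta> s i * (a - b)\<^sup>2"
    using AE_L2_fibre[OF h] AE_disintegration[OF ab(1)] AE_disintegration[OF ab(2)]
  proof eventually_elim
    case (elim i)
    interpret k: prob_space "\<kappa> i" by (rule prob_kappa)
    let ?h = "\<lambda>j. h (e i j)"
    have "osc_norm (\<kappa> i) ?h \<le> ereal (a - b)"
      using elim by (intro osc_norm_leI) (auto simp: L2_def)
    \<comment> \<open>The bound \<open>0 \<le> t\<close> is what allows the oscillation bound to be
      squared.\<close>
    then obtain t where t: "osc_norm (\<kappa> i) ?h = ereal t" "0 \<le> t" "t \<le> a - b"
      using k.osc_norm_nonneg[of ?h] by (cases "osc_norm (\<kappa> i) ?h") auto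
    have "prob_space.variance (\<kappa> i) ?h \<le> s * dirichlet_form (\<kappa> i) (kernel_op (H i)) ?h + \<beta> s i * t\<^sup>2"
      using wpi[OF elim(1)] by (simp add: t(1))
    also have "\<dots> \<le> s * dirichlet_form (\<kappa> i) (kernel_op (H i)) ?h + \<beta> s i * (a - b)\<^sup>2"
      using t beta(2) by (intro add_left_mono mult_left_mono power_mono) auto
    finally show ?case
      unfolding variance_eq_dirichlet_form[OF prob_kappa elim(1)] by (simp add: kernel_op_def[abs_def])
  qed
  then have "(\<integral>i. dirichlet_form (\<kappa> i) (kernel_op (\<lambda>j. \<kappa> i)) (\<lambda>j. h (e i j)) \<partial>N)
      \<le> (\<integral>i. s * dirichlet_form (\<kappa> i) (kernel_op (H i)) (\<lambda>j. h (e i j)) + \<beta> s i * (a - b)\<^sup>2 \<partial>N)"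
    using bi integrable_dirichlet_form_fibre[OF H h] integrable_dirichlet_form_fibre[OF reversible_fibres_kappa h]
    by (intro integral_mono_AE) auto
  also have "\<dots> = s * dirichlet_form \<pi> (fibre_op H) h + r * (a - b)\<^sup>2"
    using bi integrable_dirichlet_form_fibre[OF H h] by (simp add: integral_dirichlet_form_fibre[OF H h] br)
  finally show ?thesis
    by (simp add: integral_dirichlet_form_fibre[OF reversible_fibres_kappa h])
qed

end

section \<open>Metropolis-within-Gibbs\<close>

lemma disintegration_fst:
  fixes \<pi> :: "('a::second_countable_topology \<times> 'b::second_countable_topology) measure"
  assumes "prob_space \<pi>" "sets \<pi> = sets borel" "conditional_Y_given_X \<pi> \<kappa>"
  shows "disintegration \<pi> fst snd Pair \<kappa>"
proof -
  interpret prob_space \<pi> by fact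
  show ?thesis
  proof
    show "fst \<in> (borel :: ('a \<times> 'b) measure) \<rightarrow>\<^sub>M borel" "snd \<in> (borel :: ('a \<times> 'b) measure) \<rightarrow>\<^sub>M borel"
      using measurable_fst[of "borel :: 'a measure" "borel :: 'b measure"]
        measurable_snd[of "borel :: 'a measure" "borel :: 'b measure"]
      by (simp_all add: borel_prod)
    show "(\<lambda>(i, j). (i :: 'a, j :: 'b)) \<in> borel \<Otimes>\<^sub>M borel \<rightarrow>\<^sub>M borel"
      by (simp add: borel_prod)
    show "emeasure \<pi> (fst -` A \<inter> snd -` B) = (\<integral>\<^sup>+i\<in>A. emeasure (\<kappa> i) B \<partial>marginal_X \<pi>)"
      if "A \<in> sets borel" "B \<in> sets borel" for A B
    proof -
      have "fst -` A \<inter> snd -` B = A \<times> B" by auto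
      then show ?thesis using assms(3) that by (simp add: conditional_Y_given_X_def)
    qed
  qed (use assms in \<open>simp_all add: conditional_Y_given_X_def\<close>)
qed

lemma disintegration_snd:
  fixes \<pi> :: "('a::second_countable_topology \<times> 'b::second_countable_topology) measure"
  assumes "prob_space \<pi>" "sets \<pi> = sets borel" "conditional_X_given_Y \<pi> \<kappa>"
  shows "disintegration \<pi> snd fst (\<lambda>y x. (x, y)) \<kappa>"
proof -
  interpret prob_space \<pi> by fact
  show ?thesis
  proof
    show "fst \<in> (borel :: ('a \<times> 'b) measure) \<rightarrow>\<^sub>M borel" "snd \<in> (borel :: ('a \<times> 'b) measure) \<rightarrow>\<^sub>M borel"
      using measurable_fst[of "borel :: 'a measure" "borel :: 'b measure"]
        measurable_snd[of "borel :: 'a measure" "borel :: 'b measure"]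
      by (simp_all add: borel_prod)
    show "(\<lambda>(i, j). (j :: 'a, i :: 'b)) \<in> borel \<Otimes>\<^sub>M borel \<rightarrow>\<^sub>M borel"
      using measurable_pair_swap'[of "borel :: 'b measure" "borel :: 'a measure"] by (simp add: borel_prod)
    show "emeasure \<pi> (snd -` A \<inter> fst -` B) = (\<integral>\<^sup>+i\<in>A. emeasure (\<kappa> i) B \<partial>marginal_Y \<pi>)"
      if "A \<in> sets borel" "B \<in> sets borel" for A B
    proof -
      have "snd -` A \<inter> fst -` B = B \<times> A" by auto
      then show ?thesis using assms(3) that by (simp add: conditional_X_given_Y_def)
    qed
  qed (use assms in \<open>simp_all add: conditional_X_given_Y_def\<close>)
qed

theorem theorem3p3:
  fixes \<pi> :: "('a::polish_space \<times> 'b::polish_space) measure"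
    and \<kappa>\<^sub>Y :: "'a \<Rightarrow> 'b measure" and \<kappa>\<^sub>X :: "'b \<Rightarrow> 'a measure"
    and H\<^sub>1 :: "'a \<Rightarrow> 'b \<Rightarrow> 'b measure" and H\<^sub>2 :: "'b \<Rightarrow> 'a \<Rightarrow> 'a measure"
    and \<beta>\<^sub>0 :: "real \<Rightarrow> real" and \<beta>\<^sub>1 :: "real \<Rightarrow> 'a \<Rightarrow> real" and \<beta>\<^sub>2 :: "real \<Rightarrow> 'b \<Rightarrow> real"
  defines "P \<equiv> (\<lambda>f. G1_op \<kappa>\<^sub>Y (G2_op \<kappa>\<^sub>X f))"
    and "P\<^sub>1\<^sub>2 \<equiv> (\<lambda>f. H1_op H\<^sub>1 (H2_op H\<^sub>2 f))"
    and "K\<^sub>0 \<equiv> Kstar (\<lambda>s. ennreal (\<beta>\<^sub>0 s))"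
    and "K\<^sub>1 \<equiv> Kstar (averaged_rate (marginal_X \<pi>) \<beta>\<^sub>1)"
    and "K\<^sub>2 \<equiv> Kstar (averaged_rate (marginal_Y \<pi>) \<beta>\<^sub>2)"
  assumes "prob_space \<pi>" and "sets \<pi> = sets borel"
    and "conditional_Y_given_X \<pi> \<kappa>\<^sub>Y" and "conditional_X_given_Y \<pi> \<kappa>\<^sub>X"
    and "(\<lambda>(x, y). H\<^sub>1 x y) \<in> borel \<rightarrow>\<^sub>M prob_algebra borel"
    and "(\<lambda>(x, y). H\<^sub>2 y x) \<in> borel \<rightarrow>\<^sub>M prob_algebra borel"
    and "\<And>x. reversible (\<kappa>\<^sub>Y x) (H\<^sub>1 x)" and "\<And>x. positive_kernel (\<kappa>\<^sub>Y x) (H\<^sub>1 x)"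
    and "\<And>s. s > 0 \<Longrightarrow> \<beta>\<^sub>1 s \<in> borel_measurable borel"
    and "\<And>x. admissible (\<lambda>s. \<beta>\<^sub>1 s x)"
    and "\<And>x s h. s > 0 \<Longrightarrow> h \<in> L2 (\<kappa>\<^sub>Y x) \<Longrightarrow>
           ereal (prob_space.variance (\<kappa>\<^sub>Y x) h)
           \<le> ereal (s * dirichlet_form (\<kappa>\<^sub>Y x) (kernel_op (H\<^sub>1 x)) h)
             + ereal (\<beta>\<^sub>1 s x) * (osc_norm (\<kappa>\<^sub>Y x) h)\<^sup>2"
    and "\<And>y. reversible (\<kappa>\<^sub>X y) (H\<^sub>2 y)" and "\<And>y. positive_kernel (\<kappa>\<^sub>X y) (H\<^sub>2 y)"
    and "\<And>s. s > 0 \<Longrightarrow> \<beta>\<^sub>2 s \<in> borel_measurable borel"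
    and "\<And>y. admissible (\<lambda>s. \<beta>\<^sub>2 s y)"
    and "\<And>y s g. s > 0 \<Longrightarrow> g \<in> L2 (\<kappa>\<^sub>X y) \<Longrightarrow>
           ereal (prob_space.variance (\<kappa>\<^sub>X y) g)
           \<le> ereal (s * dirichlet_form (\<kappa>\<^sub>X y) (kernel_op (H\<^sub>2 y)) g)
             + ereal (\<beta>\<^sub>2 s y) * (osc_norm (\<kappa>\<^sub>X y) g)\<^sup>2"
    and "admissible \<beta>\<^sub>0"
    and "\<And>s f. s > 0 \<Longrightarrow> f \<in> L2_mean_zero \<pi> \<Longrightarrow>
           ereal (L2_norm_sq \<pi> f)
           \<le> ereal (s * dirichlet_form \<pi> (\<lambda>g. L2_adjoint \<pi> P (P g)) f)
             + ereal (\<beta>\<^sub>0 s) * (osc_norm \<pi> f)\<^sup>2"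
    and "normalised (\<lambda>s. ennreal (\<beta>\<^sub>0 s))"
    and "normalised (averaged_rate (marginal_X \<pi>) \<beta>\<^sub>1)"
    and "normalised (averaged_rate (marginal_Y \<pi>) \<beta>\<^sub>2)"
  shows "\<forall>f \<in> L2_mean_zero \<pi>. 0 < osc_norm \<pi> f \<and> osc_norm \<pi> f < \<infinity> \<longrightarrow>
    ereal (dirichlet_form \<pi> (\<lambda>g. L2_adjoint \<pi> P\<^sub>1\<^sub>2 (P\<^sub>1\<^sub>2 g)) f) / (osc_norm \<pi> f)\<^sup>2
    \<ge> 2 * K\<^sub>1 (K\<^sub>2 (1 / 2 * K\<^sub>0 (ereal (L2_norm_sq \<pi> f) / (osc_norm \<pi> f)\<^sup>2 / 4)))"
proof (intro ballI impI)
  \<comment> \<open>The first five assumptions are the defining equations, so \<open>a\<close>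
    starts with the hypotheses proper.\<close>
  note a = assms(6-)
  fix f assume f0: "f \<in> L2_mean_zero \<pi>" and osc: "0 < osc_norm \<pi> f \<and> osc_norm \<pi> f < \<infinity>"
  interpret prob_space \<pi> by (rule a(1))
  interpret X: disintegration \<pi> fst snd Pair \<kappa>\<^sub>Y
    using a(1-3) by (rule disintegration_fst)
  interpret Y: disintegration \<pi> snd fst "\<lambda>y x. (x, y)" \<kappa>\<^sub>X
    using a(1,2,4) by (rule disintegration_snd)
  have H1: "X.reversible_fibres H\<^sub>1"
    using a(5,7) by (simp add: X.reversible_fibres_def case_prod_unfold)
  have H2: "Y.reversible_fibres H\<^sub>2"
    using a(6,12) by (simp add: Y.reversible_fibres_def case_prod_unfold)
  let ?G1 = "X.gibbs_op" and ?G2 = "Y.gibbs_op"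
    and ?T1 = "X.fibre_op H\<^sub>1" and ?T2 = "Y.fibre_op H\<^sub>2"
  have P_eq: "P = (\<lambda>f. ?G1 (?G2 f))"
    by (simp add: P_def fun_eq_iff X.fibre_op_def Y.fibre_op_def G1_op_def G2_op_def)
  have P12_eq: "P\<^sub>1\<^sub>2 = (\<lambda>f. ?T1 (?T2 f))"
    by (simp add: P\<^sub>1\<^sub>2_def fun_eq_iff X.fibre_op_def Y.fibre_op_def H1_op_def H2_op_def)
  note G1 = X.symmetric_contraction_gibbs_op and G2 = Y.symmetric_contraction_gibbs_op
  note T1 = X.symmetric_contraction_fibre_op[OF H1] and T2 = Y.symmetric_contraction_fibre_op[OF H2]

  have f: "f \<in> L2 \<pi>" using f0 by (simp add: L2_mean_zero_def)
  define h where "h = ?T2 f"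
  have h: "h \<in> L2 \<pi>" unfolding h_def by (rule symmetric_contraction_L2[OF T2 f])
  obtain M m where Mm: "AE z in \<pi>. f z \<le> M" "AE z in \<pi>. m \<le> f z" and osc_eq: "osc_norm \<pi> f = ereal (M - m)"
    using osc osc_norm_bounds by metis
  \<comment> \<open>Since \<open>h\<close> inherits the bounds of \<open>f\<close>, the same squared
    oscillation \<open>w\<close> serves for both.\<close>
  have hMm: "AE z in \<pi>. h z \<le> M" "AE z in \<pi>. m \<le> h z"
    unfolding h_def using Y.fibre_op_AE_le[OF H2 f Mm(1)] Y.fibre_op_AE_ge[OF H2 f Mm(2)] by auto
  define w where "w = (M - m)\<^sup>2"
  have w: "0 < w" using osc by (simp add: w_def osc_eq)
  have osc_sq: "(osc_norm \<pi> f)\<^sup>2 = ereal w" by (simp add: osc_eq w_def)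

  define n where "n = L2_inner \<pi> f f"
  define A where "A = n - L2_inner \<pi> h h"
  define B where "B = L2_inner \<pi> h h - L2_inner \<pi> (?T1 h) (?T1 h)"
  define C where "C = dirichlet_form \<pi> ?G1 h"
  define E where "E = dirichlet_form \<pi> ?G2 f"
  \<comment> \<open>This bound puts \<open>A / w\<close> and \<open>C / w\<close> into [0, 1/4], the
    range of the normalisation.\<close>
  have n_le: "n \<le> w / 4"
    unfolding n_def w_def by (rule mean_zero_norm_le[OF a(1) f0 Mm])
  have hh: "L2_inner \<pi> h h \<le> n"
    unfolding h_def n_def by (rule symmetric_contraction_le[OF T2 f])
  have A: "0 \<le> A" "A \<le> w / 4"
    using hh n_le L2_inner_self_nonneg[of \<pi> h] by (auto simp: A_def)
  have B: "0 \<le> B" using symmetric_contraction_le[OF T1 h] by (simp add: B_def)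
  have C0: "0 \<le> C" unfolding C_def by (rule dirichlet_form_nonneg[OF G1 h])
  have E0: "0 \<le> E" unfolding E_def by (rule dirichlet_form_nonneg[OF G2 f])
  have "C \<le> L2_inner \<pi> h h"
    unfolding C_def
  proof (rule dirichlet_form_le_norm[where T="?G1", OF h symmetric_contraction_L2[OF G1 h]])
    \<comment> \<open>By symmetry and idempotence this is the squared norm of
      \<open>?G1 h\<close>.\<close>
    show "0 \<le> L2_inner \<pi> (?G1 h) h"
      using symmetric_contraction_symm[OF G1 symmetric_contraction_L2[OF G1 h] h] L2_inner_self_nonneg[of \<pi> "?G1 h"]
      by (simp add: X.fibre_op_gibbs_op[OF X.reversible_fibres_kappa])
  qed
  then have C_le: "C \<le> w / 4" using hh n_le by simp
  \<comment> \<open>Positivity of the fibre kernels enters here and in \<open>CB\<close>: it makes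
    the energy of an update at most its loss of squared norm.\<close>
  have EA: "dirichlet_form \<pi> ?T2 f \<le> A"
    unfolding A_def n_def h_def
    by (rule dirichlet_form_le_square[OF T2 Y.fibre_op_positive[OF H2 a(13)] f])
  have CB: "dirichlet_form \<pi> ?T1 h \<le> B"
    unfolding B_def
    by (rule dirichlet_form_le_square[OF T1 X.fibre_op_positive[OF H1 a(8)] h])
  have gap: "dirichlet_form \<pi> (\<lambda>g. L2_adjoint \<pi> P (P g)) f \<le> 2 * C + 3 * E"
    unfolding P_eq dirichlet_form_adjoint_comp[OF G1 G2 f] C_def E_def h_def
    by (rule gibbs_comparison[OF G1 G2 T2 _ _ _ f])
       (simp_all add: X.fibre_op_gibbs_op[OF X.reversible_fibres_kappa]
          Y.fibre_op_gibbs_op[OF Y.reversible_fibres_kappa] Y.fibre_op_gibbs_op[OF H2])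
  have total: "dirichlet_form \<pi> (\<lambda>g. L2_adjoint \<pi> P\<^sub>1\<^sub>2 (P\<^sub>1\<^sub>2 g)) f = A + B"
    unfolding P12_eq dirichlet_form_adjoint_comp[OF T1 T2 f] by (simp add: A_def B_def n_def h_def)
  have norm: "L2_norm_sq \<pi> f = n" by (simp add: L2_norm_sq_def n_def L2_inner_def power2_eq_square)

  \<comment> \<open>Division by \<open>w\<close> brings the inequalities into the form with squared
    oscillation 1 that \<open>Kstar_leI_rate\<close> takes.\<close>
  have scale: "x / w \<le> s * (y / w) + b" if "x \<le> s * y + b * w" for x y s b :: real
    using divide_right_mono[OF that, of w] w by (simp add: add_divide_distrib)
  have K0: "K\<^sub>0 (ereal (n / w)) \<le> ereal (2 * (C / w) + 3 * (E / w))"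
    unfolding K\<^sub>0_def
  proof (rule Kstar_leI_rate)
    show "0 \<le> 2 * (C / w) + 3 * (E / w)" using C0 E0 w by simp
    fix s b :: real assume s: "0 < s" and b: "0 \<le> b" "ennreal (\<beta>\<^sub>0 s) = ennreal b"
    \<comment> \<open>Admissibility makes \<open>\<beta>\<^sub>0 s\<close> nonnegative, and
      \<open>ennreal\<close> is injective on nonnegative reals.\<close>
    have "\<beta>\<^sub>0 s = b" using a(17) s b by (simp add: admissible_def)
    then have "n \<le> s * dirichlet_form \<pi> (\<lambda>g. L2_adjoint \<pi> P (P g)) f + b * w"
      using a(18)[OF s f0] by (simp add: norm osc_sq)
    also have "\<dots> \<le> s * (2 * C + 3 * E) + b * w"
      using gap s by simp
    finally have "n / w \<le> s * ((2 * C + 3 * E) / w) + b" by (rule scale)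
    then show "n / w \<le> s * (2 * (C / w) + 3 * (E / w)) + b" by (simp add: add_divide_distrib)
  qed
  have K2: "K\<^sub>2 (ereal (E / w)) \<le> ereal (A / w)"
    unfolding K\<^sub>2_def
  proof (rule Kstar_leI_rate)
    show "0 \<le> A / w" using A w by simp
    fix s b :: real assume s: "0 < s" and b: "0 \<le> b" "averaged_rate (marginal_Y \<pi>) \<beta>\<^sub>2 s = ennreal b"
    have "E \<le> s * dirichlet_form \<pi> ?T2 f + b * w"
      unfolding E_def w_def
      by (rule Y.dirichlet_form_gibbs_op_le[OF H2 s a(16)[OF s] a(14)[OF s] _ b(2,1) f Mm])
         (use a(15) s in \<open>auto simp: admissible_def\<close>)
    also have "\<dots> \<le> s * A + b * w" using EA s by simp
    finally show "E / w \<le> s * (A / w) + b" by (rule scale)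
  qed
  have K1: "K\<^sub>1 (ereal (C / w)) \<le> ereal (B / w)"
    unfolding K\<^sub>1_def
  proof (rule Kstar_leI_rate)
    show "0 \<le> B / w" using B w by simp
    fix s b :: real assume s: "0 < s" and b: "0 \<le> b" "averaged_rate (marginal_X \<pi>) \<beta>\<^sub>1 s = ennreal b"
    have "C \<le> s * dirichlet_form \<pi> ?T1 h + b * w"
      unfolding C_def w_def
      by (rule X.dirichlet_form_gibbs_op_le[OF H1 s a(11)[OF s] a(9)[OF s] _ b(2,1) h hMm])
         (use a(10) s in \<open>auto simp: admissible_def\<close>)
    also have "\<dots> \<le> s * B + b * w" using CB s by simp
    finally show "C / w \<le> s * (B / w) + b" by (rule scale)
  qed
  have "2 * K\<^sub>1 (K\<^sub>2 (1 / 2 * K\<^sub>0 (ereal (n / w) / 4))) \<le> ereal (A / w + B / w)"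
    unfolding K\<^sub>0_def K\<^sub>1_def K\<^sub>2_def
    by (rule Kstar_chain[OF K0[unfolded K\<^sub>0_def] K2[unfolded K\<^sub>2_def] K1[unfolded K\<^sub>1_def] a(20,21)])
       (use A C0 C_le E0 w in \<open>simp_all add: field_simps\<close>)
  then show "ereal (dirichlet_form \<pi> (\<lambda>g. L2_adjoint \<pi> P\<^sub>1\<^sub>2 (P\<^sub>1\<^sub>2 g)) f) / (osc_norm \<pi> f)\<^sup>2
    \<ge> 2 * K\<^sub>1 (K\<^sub>2 (1 / 2 * K\<^sub>0 (ereal (L2_norm_sq \<pi> f) / (osc_norm \<pi> f)\<^sup>2 / 4)))"
    using w by (simp add: total norm osc_sq add_divide_distrib)
qed

end
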